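(* Let $G$ be a simple graph of size $s>0$ having a vertex labeling $\sigma$ with $\operatorname{FR}(A_\sigma)=\mathcal E(G)/\sqrt{2s}$ (such a graph is necessarily regular). Let $a$ be its common vertex degree, and let $\Lambda$ be its Laplacian spectrum (set of eigenvalues of the Laplacian). If $\lambda\in\Lambda$ and $2a-\lambda\notin\Lambda$, then $$\operatorname{FR}(\Pi_{\lambda,\sigma})=\operatorname{FR}_{\min}(\Pi_\lambda)=\sqrt{m(\lambda)},$$ where $m(\lambda)$ is the multiplicity of the Laplacian eigenvalue $\lambda$.
   Context: Graphs are finite, simple and undirected. A vertex labeling of a graph $G=(V,E)$ of order $N=|V|$ is a bijection $\sigma:V\to\mathbb Z_N=\mathbb Z/N\mathbb Z$. The adjacency matrix under $\sigma$ is the $N\times N$ matrix $A_\sigma$, indexed by $\mathbb Z_N\times\mathbb Z_N$, with $(A_\sigma)_{x,y}=1$ if the vertices labeled $x$ and $y$ are adjacent and $0$ otherwise. $F$ is the unitary Fourier matrix $F_{mx}=\frac1{\sqrt N}e^{-2\pi i mx/N}$. The Fourier ratio of a nonzero $N\times N$ matrix $M$ is $\operatorname{FR}(M)=\|FMF\|_1/\|FMF\|_2$, where $\|\cdot\|_1$ is the entrywise $\ell^1$-norm and $\|\cdot\|_2$ the Frobenius norm. The graph energy $\mathcal E(G)$ is the sum of the absolute values of the adjacency eigenvalues counted with multiplicity. For an eigenvalue $\lambda$ of the graph Laplacian $L=D-A$, $\Pi_{\lambda,\tau}$ denotes the matrix of the orthogonal projector onto the $\lambda$-eigenspace of $L$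 written under the vertex labeling $\tau$, and $\operatorname{FR}_{\min}(\Pi_\lambda)=\min_\tau\operatorname{FR}(\Pi_{\lambda,\tau})$, the minimum over all vertex labelings $\tau$. *)

theory Defs
  imports
    Complex_Main
    "HOL-Library.FuncSet"
    "Jordan_Normal_Form.Spectral_Radius"
begin

definition simple_graph :: "'v set \<Rightarrow> 'v set set \<Rightarrow> bool" where
  "simple_graph V E \<longleftrightarrow> finite V \<and> (\<forall>e\<in>E. e \<subseteq> V \<and> card e = 2)"

definition degree_of :: "'v set set \<Rightarrow> 'v \<Rightarrow> nat" where
  "degree_of E v = card {e \<in> E. v \<in> e}"

text \<open>The residues modulo N are represented by 0, ..., N - 1, where N is the order of the graph.
  Only the values of a labeling on V matter.\<close>

definition vertex_labeling :: "'v set \<Rightarrow> ('v \<Rightarrow> nat) \<Rightarrow> bool" where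
  "vertex_labeling V \<sigma> \<longleftrightarrow> bij_betw \<sigma> V {0..<card V}"

definition labeled_mat :: "'v set \<Rightarrow> ('v \<Rightarrow> nat) \<Rightarrow> ('v \<Rightarrow> 'v \<Rightarrow> complex) \<Rightarrow> complex mat" where
  "labeled_mat V \<sigma> g = mat (card V) (card V) (\<lambda>(x, y). g (inv_into V \<sigma> x) (inv_into V \<sigma> y))"

definition adjacency_mat :: "'v set \<Rightarrow> 'v set set \<Rightarrow> ('v \<Rightarrow> nat) \<Rightarrow> complex mat" where
  "adjacency_mat V E \<sigma> = labeled_mat V \<sigma> (\<lambda>u v. if {u, v} \<in> E then 1 else 0)"

definition degree_mat :: "'v set \<Rightarrow> 'v set set \<Rightarrow> ('v \<Rightarrow> nat) \<Rightarrow> complex mat" where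
  "degree_mat V E \<sigma> = labeled_mat V \<sigma> (\<lambda>u v. if u = v then of_nat (degree_of E u) else 0)"

definition laplacian_mat :: "'v set \<Rightarrow> 'v set set \<Rightarrow> ('v \<Rightarrow> nat) \<Rightarrow> complex mat" where
  "laplacian_mat V E \<sigma> = degree_mat V E \<sigma> - adjacency_mat V E \<sigma>"

definition fourier_mat :: "nat \<Rightarrow> complex mat" where
  "fourier_mat N = mat N N (\<lambda>(m, x).
     complex_of_real (1 / sqrt (real N)) * exp (- 2 * complex_of_real pi * \<i> * of_nat m * of_nat x / of_nat N))"

definition l1_norm_mat :: "complex mat \<Rightarrow> real" where
  "l1_norm_mat M = (\<Sum>i<dim_row M. \<Sum>j<dim_col M. cmod (M $$ (i, j)))"

definition frobenius_norm :: "complex mat \<Rightarrow> real" where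
  "frobenius_norm M = sqrt (\<Sum>i<dim_row M. \<Sum>j<dim_col M. (cmod (M $$ (i, j)))\<^sup>2)"

text \<open>Meant for nonzero square matrices; for the zero matrix the quotient is 0 by convention.\<close>

definition fourier_ratio :: "complex mat \<Rightarrow> real" where
  "fourier_ratio M = (let F = fourier_mat (dim_row M)
     in l1_norm_mat (F * M * F) / frobenius_norm (F * M * F))"

text \<open>Energy, Laplacian spectrum and multiplicities belong to the graph, not to a labeling. They are
  read off from the matrix under an arbitrarily chosen labeling; by
  \<open>char_poly_adjacency_mat\<close>, \<open>char_poly_laplacian_mat\<close> and \<open>spectrum_laplacian_mat\<close> below, the choice
  is irrelevant. Eigenvalues are taken over the complex numbers, with algebraic multiplicities.\<close>

definition chosen_labeling :: "'v set \<Rightarrow> 'v \<Rightarrow> nat" where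
  "chosen_labeling V = (SOME \<sigma>. vertex_labeling V \<sigma>)"

definition graph_energy :: "'v set \<Rightarrow> 'v set set \<Rightarrow> real" where
  "graph_energy V E = (let A = adjacency_mat V E (chosen_labeling V)
     in \<Sum>\<mu>\<in>spectrum A. real (order \<mu> (char_poly A)) * cmod \<mu>)"

definition laplacian_spectrum :: "'v set \<Rightarrow> 'v set set \<Rightarrow> complex set" where
  "laplacian_spectrum V E = spectrum (laplacian_mat V E (chosen_labeling V))"

definition laplacian_multiplicity :: "'v set \<Rightarrow> 'v set set \<Rightarrow> complex \<Rightarrow> nat" where
  "laplacian_multiplicity V E \<mu> = order \<mu> (char_poly (laplacian_mat V E (chosen_labeling V)))"

definition eigenspace :: "complex mat \<Rightarrow> complex \<Rightarrow> complex vec set" where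
  "eigenspace M \<mu> = {v \<in> carrier_vec (dim_row M). M *\<^sub>v v = \<mu> \<cdot>\<^sub>v v}"

text \<open>The orthogonal projector onto a subspace W sends v to the element of W whose difference
  from v is orthogonal to W.\<close>

definition is_orthogonal_projector :: "nat \<Rightarrow> complex vec set \<Rightarrow> complex mat \<Rightarrow> bool" where
  "is_orthogonal_projector n W P \<longleftrightarrow> P \<in> carrier_mat n n \<and>
     (\<forall>v\<in>carrier_vec n. P *\<^sub>v v \<in> W \<and> (\<forall>w\<in>W. (v - P *\<^sub>v v) \<bullet>c w = 0))"

definition orthogonal_projector :: "nat \<Rightarrow> complex vec set \<Rightarrow> complex mat" where
  "orthogonal_projector n W = (THE P. is_orthogonal_projector n W P)"

definition laplacian_projector ::
    "'v set \<Rightarrow> 'v set set \<Rightarrow> complex \<Rightarrow> ('v \<Rightarrow> nat) \<Rightarrow> complex mat" where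
  "laplacian_projector V E \<mu> \<tau> = orthogonal_projector (card V) (eigenspace (laplacian_mat V E \<tau>) \<mu>)"

text \<open>The set is finite by \<open>finite_projector_ratios\<close> below, so \<^const>\<open>Min\<close> is a genuine minimum.\<close>

definition fourier_ratio_min :: "'v set \<Rightarrow> 'v set set \<Rightarrow> complex \<Rightarrow> real" where
  "fourier_ratio_min V E \<mu> =
     Min {fourier_ratio (laplacian_projector V E \<mu> \<tau>) | \<tau>. vertex_labeling V \<tau>}"

lemma vertex_labeling_chosen:
  assumes "finite V"
  shows "vertex_labeling V (chosen_labeling V)"
proof -
  have "\<exists>\<sigma>. vertex_labeling V \<sigma>"
    using ex_bij_betw_finite_nat[OF assms] by (simp add: vertex_labeling_def)
  thus ?thesis
    unfolding chosen_labeling_def by (rule someI_ex)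
qed

lemma inv_into_labeling:
  assumes "vertex_labeling V \<sigma>"
  shows "bij_betw (inv_into V \<sigma>) {0..<card V} V"
  using assms unfolding vertex_labeling_def by (rule bij_betw_inv_into)

lemma labeled_mat_similar:
  assumes s: "vertex_labeling V \<sigma>" and t: "vertex_labeling V \<tau>"
  shows "similar_mat (labeled_mat V \<sigma> g) (labeled_mat V \<tau> g)"
proof -
  define n where "n = card V"
  define R where "R \<alpha> \<beta> = mat n n (\<lambda>(x, y). if inv_into V \<alpha> x = inv_into V \<beta> y then 1 else (0::complex))"
    for \<alpha> \<beta>
  define M where "M \<alpha> \<beta> = mat n n (\<lambda>(x, y). g (inv_into V \<alpha> x) (inv_into V \<beta> y))" for \<alpha> \<beta>
  have sum_delta: "(\<Sum>z = 0..<n. (if u = inv_into V \<beta> z then 1 else 0) * f (inv_into V \<beta> z)) = f u"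
    if b: "vertex_labeling V \<beta>" and u: "u \<in> V" for \<beta> u and f :: "'a \<Rightarrow> complex"
  proof -
    have fin: "finite V"
      using inv_into_labeling[OF b] bij_betw_finite by fastforce
    have "(\<Sum>z = 0..<n. (if u = inv_into V \<beta> z then 1 else 0) * f (inv_into V \<beta> z))
        = (\<Sum>w\<in>V. (if u = w then 1 else 0) * f w)"
      using sum.reindex_bij_betw[OF inv_into_labeling[OF b], of "\<lambda>w. (if u = w then 1 else 0) * f w"]
      by (simp add: n_def)
    also have "\<dots> = (\<Sum>w\<in>V. if u = w then f w else 0)"
      by (rule sum.cong) auto
    also have "\<dots> = f u"
      using fin u by simp
    finally show ?thesis .
  qed
  have inV: "inv_into V \<alpha> x \<in> V" if "vertex_labeling V \<alpha>" "x < n" for \<alpha> x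
    using inv_into_labeling[OF that(1)] that(2) by (auto simp: n_def bij_betw_def)
  have RR: "R \<alpha> \<beta> * R \<beta> \<alpha> = 1\<^sub>m n" if a: "vertex_labeling V \<alpha>" and b: "vertex_labeling V \<beta>" for \<alpha> \<beta>
  proof (rule eq_matI)
    fix x y assume "x < dim_row (1\<^sub>m n)" "y < dim_col (1\<^sub>m n)"
    hence xy: "x < n" "y < n" by auto
    have "(R \<alpha> \<beta> * R \<beta> \<alpha>) $$ (x, y) = (if inv_into V \<alpha> x = inv_into V \<alpha> y then 1 else 0)"
      using xy sum_delta[OF b inV[OF a xy(1)], of "\<lambda>w. if w = inv_into V \<alpha> y then 1 else 0"]
      by (simp add: R_def scalar_prod_def)
    moreover have "inv_into V \<alpha> x = inv_into V \<alpha> y \<longleftrightarrow> x = y"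
      using inv_into_labeling[OF a] xy by (auto simp: n_def bij_betw_def inj_on_def)
    ultimately show "(R \<alpha> \<beta> * R \<beta> \<alpha>) $$ (x, y) = 1\<^sub>m n $$ (x, y)"
      using xy by simp
  qed (auto simp: R_def)
  have RM: "R \<sigma> \<tau> * M \<tau> \<tau> = M \<sigma> \<tau>"
  proof (rule eq_matI)
    fix x y assume "x < dim_row (M \<sigma> \<tau>)" "y < dim_col (M \<sigma> \<tau>)"
    hence xy: "x < n" "y < n" by (auto simp: M_def)
    show "(R \<sigma> \<tau> * M \<tau> \<tau>) $$ (x, y) = M \<sigma> \<tau> $$ (x, y)"
      using xy sum_delta[OF t inV[OF s xy(1)], of "\<lambda>w. g w (inv_into V \<tau> y)"]
      by (simp add: R_def M_def scalar_prod_def)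
  qed (auto simp: R_def M_def)
  have MR: "M \<sigma> \<tau> * R \<tau> \<sigma> = M \<sigma> \<sigma>"
  proof (rule eq_matI)
    fix x y assume "x < dim_row (M \<sigma> \<sigma>)" "y < dim_col (M \<sigma> \<sigma>)"
    hence xy: "x < n" "y < n" by (auto simp: M_def)
    have "(M \<sigma> \<tau> * R \<tau> \<sigma>) $$ (x, y) = (\<Sum>z = 0..<n. g (inv_into V \<sigma> x) (inv_into V \<tau> z) *
        (if inv_into V \<tau> z = inv_into V \<sigma> y then 1 else 0))"
      using xy by (simp add: R_def M_def scalar_prod_def)
    also have "\<dots> = (\<Sum>z = 0..<n. (if inv_into V \<sigma> y = inv_into V \<tau> z then 1 else 0) *
        g (inv_into V \<sigma> x) (inv_into V \<tau> z))"
      by (rule sum.cong) auto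
    also have "\<dots> = g (inv_into V \<sigma> x) (inv_into V \<sigma> y)"
      by (rule sum_delta[OF t inV[OF s xy(2)]])
    finally show "(M \<sigma> \<tau> * R \<tau> \<sigma>) $$ (x, y) = M \<sigma> \<sigma> $$ (x, y)"
      using xy by (simp add: M_def)
  qed (auto simp: R_def M_def)
  have "similar_mat (M \<sigma> \<sigma>) (M \<tau> \<tau>)"
    by (rule similar_matI[of _ _ "R \<sigma> \<tau>" "R \<tau> \<sigma>" n])
       (use RR[OF s t] RR[OF t s] RM MR in \<open>auto simp: R_def M_def\<close>)
  thus ?thesis
    by (simp add: M_def labeled_mat_def n_def)
qed

lemma char_poly_adjacency_mat:
  assumes "vertex_labeling V \<sigma>" and "vertex_labeling V \<tau>"
  shows "char_poly (adjacency_mat V E \<sigma>) = char_poly (adjacency_mat V E \<tau>)"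
  unfolding adjacency_mat_def by (rule char_poly_similar[OF labeled_mat_similar[OF assms]])

lemma laplacian_mat_labeled_mat:
  "laplacian_mat V E \<sigma> = labeled_mat V \<sigma>
     (\<lambda>u v. (if u = v then of_nat (degree_of E u) else 0) - (if {u, v} \<in> E then 1 else 0))"
  unfolding laplacian_mat_def degree_mat_def adjacency_mat_def labeled_mat_def
  by (rule eq_matI) auto

lemma char_poly_laplacian_mat:
  assumes "vertex_labeling V \<sigma>" and "vertex_labeling V \<tau>"
  shows "char_poly (laplacian_mat V E \<sigma>) = char_poly (laplacian_mat V E \<tau>)"
  unfolding laplacian_mat_labeled_mat by (rule char_poly_similar[OF labeled_mat_similar[OF assms]])

lemma spectrum_laplacian_mat:
  assumes "vertex_labeling V \<sigma>" and "vertex_labeling V \<tau>"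
  shows "spectrum (laplacian_mat V E \<sigma>) = spectrum (laplacian_mat V E \<tau>)"
proof -
  have carr: "laplacian_mat V E \<rho> \<in> carrier_mat (card V) (card V)" for \<rho>
    by (simp add: laplacian_mat_labeled_mat labeled_mat_def)
  thus ?thesis
    using char_poly_laplacian_mat[OF assms, of E]
    by (simp add: spectrum_root_char_poly[OF carr])
qed

lemma finite_projector_ratios:
  assumes "finite V"
  shows "finite {fourier_ratio (laplacian_projector V E \<mu> \<tau>) | \<tau>. vertex_labeling V \<tau>}"
proof -
  let ?f = "\<lambda>\<tau>. fourier_ratio (laplacian_projector V E \<mu> \<tau>)"
  have inv_eq: "inv_into V (restrict \<tau> V) = inv_into V \<tau>" for \<tau> :: "'a \<Rightarrow> nat"
  proof
    fix x
    have "(\<lambda>y. y \<in> V \<and> restrict \<tau> V y = x) = (\<lambda>y. y \<in> V \<and> \<tau> y = x)" by auto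
    thus "inv_into V (restrict \<tau> V) x = inv_into V \<tau> x" by (simp add: inv_into_def)
  qed
  have "?f \<tau> \<in> ?f ` (V \<rightarrow>\<^sub>E {0..<card V})" if "vertex_labeling V \<tau>" for \<tau>
  proof -
    have "restrict \<tau> V \<in> V \<rightarrow>\<^sub>E {0..<card V}"
      using that by (auto simp: vertex_labeling_def bij_betw_def)
    moreover have "?f (restrict \<tau> V) = ?f \<tau>"
      unfolding laplacian_projector_def laplacian_mat_labeled_mat labeled_mat_def inv_eq by (rule refl)
    ultimately show ?thesis by (metis imageI)
  qed
  hence "{?f \<tau> | \<tau>. vertex_labeling V \<tau>} \<subseteq> ?f ` (V \<rightarrow>\<^sub>E {0..<card V})" by blast
  moreover have "finite (?f ` (V \<rightarrow>\<^sub>E {0..<card V}))"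
    using assms by (intro finite_imageI finite_PiE) auto
  ultimately show ?thesis by (rule finite_subset)
qed

end

theory Submission
  imports Defs
begin

text \<open>Write \<open>B = F A F\<close>. The matrices \<open>A\<close> and \<open>B\<close> have the same singular values, so the hypothesis says that
  the entrywise \<open>l\<^sup>1\<close>-norm of \<open>B\<close> equals its trace norm, which forces \<open>B\<close> to have at most one nonzero
  entry in each row and column. The position (0, 0) is one of them, and this makes the graph regular.
  Then \<open>F\<^sup>* A\<^sup>2 F = B\<^sup>* B\<close> is diagonal. If \<open>- \<nu>\<close> is not an eigenvalue of \<open>A\<close>, where \<open>\<nu> = a - \<lambda>\<close>, the
  \<open>\<nu>\<close>-eigenspace of \<open>A\<close> is an eigenspace of \<open>A\<^sup>2\<close>, so all entries of \<open>F \<Pi> F\<close> have modulus 0 or 1. For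
  every orthogonal projector \<open>\<Pi>\<close> of rank \<open>m\<close>, the entries of \<open>F \<Pi> F\<close> have modulus at most 1 and the
  squares of their moduli sum to \<open>m\<close>; hence the Fourier ratio is at least \<open>\<surd>m\<close>, with equality if all
  moduli are 0 or 1.\<close>

section \<open>Adjoints and unitary matrices\<close>

lemma mat_adjoint_carrier [simp]:
  "A \<in> carrier_mat n m \<Longrightarrow> mat_adjoint A \<in> carrier_mat m n"
  by (auto simp: mat_adjoint_def mat_of_rows_def)

lemma dim_mat_adjoint [simp]:
  "dim_row (mat_adjoint A) = dim_col A" "dim_col (mat_adjoint A) = dim_row A"
  by (auto simp: mat_adjoint_def mat_of_rows_def)

lemma index_mat_adjoint [simp]:
  fixes A :: "complex mat"
  assumes "i < dim_col A" "j < dim_row A"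
  shows "mat_adjoint A $$ (i, j) = cnj (A $$ (j, i))"
  using assms by (simp add: mat_adjoint_def mat_of_rows_def cols_def)

lemma mat_adjoint_adjoint [simp]: "mat_adjoint (mat_adjoint (A :: complex mat)) = A"
  by (rule eq_matI) auto

lemma mat_adjoint_mult:
  fixes A B :: "complex mat"
  assumes "A \<in> carrier_mat n m" "B \<in> carrier_mat m k"
  shows "mat_adjoint (A * B) = mat_adjoint B * mat_adjoint A"
proof (rule eq_matI)
  fix i j
  assume "i < dim_row (mat_adjoint B * mat_adjoint A)" "j < dim_col (mat_adjoint B * mat_adjoint A)"
  with assms show "mat_adjoint (A * B) $$ (i, j) = (mat_adjoint B * mat_adjoint A) $$ (i, j)"
    by (auto simp: scalar_prod_def ac_simps intro!: sum.cong)
qed (use assms in auto)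

lemma mat_adjoint_mat_diag: "mat_adjoint (mat_diag n f) = mat_diag n (\<lambda>i. cnj (f i))"
  by (rule eq_matI) (auto simp: mat_diag_def)

lemma adjoint_cscalar_prod:
  fixes A :: "complex mat"
  assumes "A \<in> carrier_mat n m" "x \<in> carrier_vec n" "y \<in> carrier_vec m"
  shows "x \<bullet>c (A *\<^sub>v y) = (mat_adjoint A *\<^sub>v x) \<bullet>c y"
proof -
  have "x \<bullet>c (A *\<^sub>v y) = (\<Sum>i<n. \<Sum>j<m. x $ i * cnj (A $$ (i, j)) * cnj (y $ j))"
    using assms by (auto simp: scalar_prod_def sum_distrib_left atLeast0LessThan intro!: sum.cong)
  also have "\<dots> = (\<Sum>j<m. \<Sum>i<n. x $ i * cnj (A $$ (i, j)) * cnj (y $ j))"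
    by (rule sum.swap)
  also have "\<dots> = (mat_adjoint A *\<^sub>v x) \<bullet>c y"
    using assms by (auto simp: scalar_prod_def sum_distrib_right atLeast0LessThan intro!: sum.cong)
  finally show ?thesis .
qed

text \<open>With a single common dimension, closure and associativity work as simplification rules
  once \<open>n\<close> is fixed; they bring products of square matrices into right-nested
  form.\<close>

lemma square_mat_mult:
  fixes A B C :: "'a :: semiring_1 mat"
  assumes "A \<in> carrier_mat n n" "B \<in> carrier_mat n n"
  shows "A * B \<in> carrier_mat n n"
    and "C \<in> carrier_mat n n \<Longrightarrow> A * B * C = A * (B * C)"
  using assms by auto

definition unitary_mat :: "nat \<Rightarrow> complex mat \<Rightarrow> bool" where
  "unitary_mat n U \<longleftrightarrow> U \<in> carrier_mat n n \<and> mat_adjoint U * U = 1\<^sub>m n \<and> U * mat_adjoint U = 1\<^sub>m n"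

text \<open>A left inverse of a square matrix is also a right inverse.\<close>

lemma unitary_matI:
  assumes "U \<in> carrier_mat n n" "mat_adjoint U * U = 1\<^sub>m n"
  shows "unitary_mat n U"
  using assms mat_mult_left_right_inverse[of "mat_adjoint U" n U] by (simp add: unitary_mat_def)

lemma unitary_matD:
  assumes "unitary_mat n U"
  shows "U \<in> carrier_mat n n" "mat_adjoint U \<in> carrier_mat n n"
    "mat_adjoint U * U = 1\<^sub>m n" "U * mat_adjoint U = 1\<^sub>m n"
  using assms by (auto simp: unitary_mat_def)

text \<open>Shaped to match right-nested products, where the cancelling pair always has a further
  factor \<open>M\<close> to its right.\<close>

lemma unitary_mat_cancel:
  assumes "unitary_mat n U" "M \<in> carrier_mat n m"
  shows "mat_adjoint U * (U * M) = M" "U * (mat_adjoint U * M) = M"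
proof -
  note U = unitary_matD[OF assms(1)]
  show "mat_adjoint U * (U * M) = M"
    using assoc_mult_mat[OF U(2) U(1) assms(2)] U(3) left_mult_one_mat[OF assms(2)] by simp
  show "U * (mat_adjoint U * M) = M"
    using assoc_mult_mat[OF U(1) U(2) assms(2)] U(4) left_mult_one_mat[OF assms(2)] by simp
qed

lemma unitary_mat_adjoint: "unitary_mat n U \<Longrightarrow> unitary_mat n (mat_adjoint U)"
  by (simp add: unitary_mat_def)

lemma unitary_mat_mult:
  assumes U: "unitary_mat n U" and W: "unitary_mat n W"
  shows "unitary_mat n (U * W)"
proof (rule unitary_matI)
  note u = unitary_matD[OF U] and w = unitary_matD[OF W]
  show "U * W \<in> carrier_mat n n" using u w by simp
  have "mat_adjoint (U * W) * (U * W) = mat_adjoint W * (mat_adjoint U * (U * W))"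
    using u w by (simp add: mat_adjoint_mult square_mat_mult[where n = n])
  also have "\<dots> = 1\<^sub>m n"
    using unitary_mat_cancel[OF U w(1)] w by simp
  finally show "mat_adjoint (U * W) * (U * W) = 1\<^sub>m n" .
qed

section \<open>Diagonalization of Hermitian matrices\<close>

text \<open>Complete \<open>v\<close> to a basis and orthogonalize it by Gram-Schmidt, which keeps
  the first vector; normalizing the columns then only rescales \<open>v\<close>, and
  \<open>c\<close> is this scale.\<close>

lemma unitary_first_column:
  fixes v :: "complex vec"
  assumes v: "v \<in> carrier_vec n" and v0: "v \<noteq> 0\<^sub>v n"
  obtains W c where "unitary_mat n W" "col W 0 = c \<cdot>\<^sub>v v"
proof -
  interpret cof_vec_space n "TYPE(complex)" .
  define b where "b = basis_completion v"
  define ws where "ws = gram_schmidt n b"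
  define W where "W = mat_of_cols n ws"
  have n: "n \<noteq> 0"
    using v v0 by (auto simp: eq_vecI)
  have b: "set b \<subseteq> carrier_vec n" "distinct b" "\<not> lin_dep (set b)" "length b = n" "hd b = v"
    using basis_completion[OF v v0] by (auto simp: b_def)
  have ws: "set ws \<subseteq> carrier_vec n" "corthogonal ws" "length ws = n"
    using gram_schmidt_result[OF b(1-3) ws_def] b(4) by auto
  obtain vs where "b = v # vs"
    using b(4,5) n by (cases b) auto
  hence "hd ws = v"
    using gram_schmidt_hd[OF v, of vs] by (simp add: ws_def)
  hence ws0: "ws ! 0 = v"
    using ws(3) n hd_conv_nth[of ws] by force
  have W: "W \<in> carrier_mat n n"
    using ws by (simp add: W_def carrier_matI)
  \<comment> \<open>The vectors \<open>ws\<close> are orthogonal but not yet of length one.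
    \<open>r j\<close> is the length of the j-th vector, and \<open>X\<close> below is
    \<open>W\<close> with its columns divided by these lengths.\<close>
  define r where "r j = sqrt (Re (ws ! j \<bullet>c ws ! j))" for j
  have wsj: "ws ! j \<in> carrier_vec n" if "j < n" for j
    using ws that by auto
  have colW: "col W j = ws ! j" if "j < n" for j
    using that ws wsj by (simp add: W_def)
  have r: "complex_of_real (r j) * complex_of_real (r j) = ws ! j \<bullet>c ws ! j" "r j \<noteq> 0" if j: "j < n" for j
  proof -
    have "ws ! j \<bullet>c ws ! j \<noteq> 0"
      using ws j by (auto simp: corthogonal_def)
    moreover have "ws ! j \<bullet>c ws ! j \<ge> 0" by auto
    ultimately have "Re (ws ! j \<bullet>c ws ! j) > 0" "Im (ws ! j \<bullet>c ws ! j) = 0"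
      by (auto simp: less_eq_complex_def complex_eq_iff)
    thus "complex_of_real (r j) * complex_of_real (r j) = ws ! j \<bullet>c ws ! j" "r j \<noteq> 0"
      by (auto simp: r_def complex_eq_iff)
  qed
  define X where "X = mat n n (\<lambda>(i, j). W $$ (i, j) / r j)"
  have X: "X \<in> carrier_mat n n"
    by (simp add: X_def)
  have "mat_adjoint X * X = 1\<^sub>m n"
  proof (rule eq_matI)
    fix i j assume "i < dim_row (1\<^sub>m n)" "j < dim_col (1\<^sub>m n)"
    hence ij: "i < n" "j < n" by auto
    have "(mat_adjoint X * X) $$ (i, j) = (\<Sum>k<n. cnj (W $$ (k, i)) * W $$ (k, j) / (r i * r j))"
      using ij X by (auto simp: scalar_prod_def X_def atLeast0LessThan intro!: sum.cong)
    also have "\<dots> = (\<Sum>k<n. W $$ (k, j) * cnj (W $$ (k, i))) / (r i * r j)"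
      by (simp add: sum_divide_distrib ac_simps)
    also have "(\<Sum>k<n. W $$ (k, j) * cnj (W $$ (k, i))) = col W j \<bullet>c col W i"
      using ij W by (auto simp: scalar_prod_def atLeast0LessThan intro!: sum.cong)
    also have "\<dots> = ws ! j \<bullet>c ws ! i"
      using colW ij by simp
    also have "\<dots> / (r i * r j) = (if i = j then 1 else 0)"
      using ws ij r[OF ij(1)] by (auto simp: corthogonal_def)
    finally show "(mat_adjoint X * X) $$ (i, j) = 1\<^sub>m n $$ (i, j)"
      using ij by simp
  qed (use X in auto)
  hence "unitary_mat n X"
    by (rule unitary_matI[OF X])
  moreover have "col X 0 = (1 / complex_of_real (r 0)) \<cdot>\<^sub>v v"
    using n v W colW[of 0] ws0 by (intro eq_vecI) (auto simp: X_def simp flip: colW)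
  ultimately show ?thesis
    by (rule that)
qed

text \<open>Deflation by induction on the dimension: conjugating by a unitary matrix whose first
  column is an eigenvector makes the first column of \<open>A\<close> a multiple of the first unit
  vector. By symmetry the same holds for the first row, and a smaller Hermitian block
  \<open>C\<close> remains.\<close>

lemma hermitian_diagonalization:
  fixes A :: "complex mat"
  assumes "A \<in> carrier_mat n n" "mat_adjoint A = A"
  shows "\<exists>U d. unitary_mat n U \<and> A = U * mat_diag n d * mat_adjoint U"
  using assms
proof (induction n arbitrary: A)
  case 0
  thus ?case
    by (intro exI[of _ "1\<^sub>m 0"] exI) (auto simp: unitary_mat_def intro!: eq_matI)
next
  case (Suc n)
  note A = \<open>A \<in> carrier_mat (Suc n) (Suc n)\<close>
  obtain e where "eigenvalue A e"
    using spectrum_non_empty[OF A] by (auto simp: spectrum_def)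
  then obtain v where v: "v \<in> carrier_vec (Suc n)" "v \<noteq> 0\<^sub>v (Suc n)" "A *\<^sub>v v = e \<cdot>\<^sub>v v"
    using A by (auto simp: eigenvalue_def eigenvector_def)
  obtain W c where W: "unitary_mat (Suc n) W" and W0: "col W 0 = c \<cdot>\<^sub>v v"
    using unitary_first_column[OF v(1,2)] .
  note w = unitary_matD[OF W]
  define B where "B = mat_adjoint W * (A * W)"
  have B: "B \<in> carrier_mat (Suc n) (Suc n)"
    using A w by (simp add: B_def square_mat_mult)
  have "mat_adjoint B = mat_adjoint W * (A * W)"
    unfolding B_def using A w Suc.prems(2)
    by (simp add: mat_adjoint_mult[where n = "Suc n" and m = "Suc n" and k = "Suc n"] square_mat_mult[where n = "Suc n"])
  hence herm: "mat_adjoint B = B"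
    by (simp add: B_def)
  have B_sym: "B $$ (i, j) = cnj (B $$ (j, i))" if "i < Suc n" "j < Suc n" for i j
    using that B herm index_mat_adjoint[of i B j] by simp
  \<comment> \<open>Column 0 of \<open>A * W\<close> is \<open>e\<close> times column 0 of
    \<open>W\<close>, so column 0 of \<open>B\<close> is \<open>e\<close> times that of
    \<open>mat_adjoint W * W\<close>, the identity.\<close>
  have col0: "B $$ (i, 0) = (if i = 0 then e else 0)" if i: "i < Suc n" for i
  proof -
    have "col (A * W) 0 = e \<cdot>\<^sub>v col W 0"
    proof -
      have "col (A * W) 0 = A *\<^sub>v (c \<cdot>\<^sub>v v)"
        using col_mult2[OF A w(1), of 0] W0 by simp
      also have "\<dots> = c \<cdot>\<^sub>v (e \<cdot>\<^sub>v v)"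
        using mult_mat_vec[OF A v(1), of c] v(3) by simp
      also have "\<dots> = e \<cdot>\<^sub>v (c \<cdot>\<^sub>v v)"
        by (simp only: smult_smult_assoc mult.commute)
      finally show ?thesis
        by (simp only: W0)
    qed
    hence "B $$ (i, 0) = e * (mat_adjoint W * W) $$ (i, 0)"
      using i w(1,2) A by (simp add: B_def)
    thus ?thesis
      unfolding w(3) using i by simp
  qed
  define C where "C = mat n n (\<lambda>(i, j). B $$ (Suc i, Suc j))"
  have C: "C \<in> carrier_mat n n"
    by (simp add: C_def)
  have "mat_adjoint C = C"
    by (rule eq_matI) (auto simp: C_def simp flip: B_sym)
  from Suc.IH[OF C this] obtain U d where U: "unitary_mat n U" and CU: "C = U * mat_diag n d * mat_adjoint U"
    by blast
  note u = unitary_matD[OF U]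
  \<comment> \<open>\<open>Z a M\<close> is block diagonal with blocks \<open>a\<close> and
    \<open>M\<close>. It respects products, and for \<open>a = 1\<close> adjoints, so the
    diagonalization of \<open>C\<close> lifts to one of \<open>B\<close>.\<close>
  define Z where "Z a M = four_block_mat (mat 1 1 (\<lambda>_. a)) (0\<^sub>m 1 n) (0\<^sub>m n 1) M"
    for a and M :: "complex mat"
  define d' where "d' i = (case i of 0 \<Rightarrow> e | Suc j \<Rightarrow> d j)" for i
  have Z: "Z a M \<in> carrier_mat (Suc n) (Suc n)" if "M \<in> carrier_mat n n" for a M
    using that by (auto simp: Z_def)
  have Z_index: "Z a M $$ (i, j) = (if i = 0 then if j = 0 then a else 0 else if j = 0 then 0 else M $$ (i - 1, j - 1))"
    if "M \<in> carrier_mat n n" "i < Suc n" "j < Suc n" for a M i j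
    using that by (auto simp: Z_def)
  have Z_adj: "mat_adjoint (Z 1 M) = Z 1 (mat_adjoint M)" if M: "M \<in> carrier_mat n n" for M
  proof (rule eq_matI)
    fix i j assume "i < dim_row (Z 1 (mat_adjoint M))" "j < dim_col (Z 1 (mat_adjoint M))"
    hence "i < Suc n" "j < Suc n"
      using Z[of "mat_adjoint M" 1] M by auto
    thus "mat_adjoint (Z 1 M) $$ (i, j) = Z 1 (mat_adjoint M) $$ (i, j)"
      using M Z[OF M, of 1] by (simp add: Z_index)
  qed (use M Z[OF M, of 1] Z[of "mat_adjoint M" 1] in auto)
  have Z_mult: "Z a M * Z b M' = Z (a * b) (M * M')"
    if M: "M \<in> carrier_mat n n" "M' \<in> carrier_mat n n" for a b M M'
  proof -
    have "mat 1 1 (\<lambda>_. a) * mat 1 1 (\<lambda>_. b) + 0\<^sub>m 1 n * 0\<^sub>m n 1 = mat 1 1 (\<lambda>_. a * b)"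
      by (rule eq_matI) (auto simp: scalar_prod_def)
    moreover have "0\<^sub>m n 1 * 0\<^sub>m 1 n + M * M' = M * M'"
      using M by simp
    moreover have "mat 1 1 (\<lambda>_. a) * 0\<^sub>m 1 n + 0\<^sub>m 1 n * M' = 0\<^sub>m 1 n"
      "0\<^sub>m n 1 * mat 1 1 (\<lambda>_. b) + M * 0\<^sub>m n 1 = 0\<^sub>m n 1"
      using M by auto
    ultimately show ?thesis
      unfolding Z_def
      using mult_four_block_mat[of "mat 1 1 (\<lambda>_. a)" 1 1 "0\<^sub>m 1 n" n "0\<^sub>m n 1" n M
          "mat 1 1 (\<lambda>_. b)" 1 "0\<^sub>m 1 n" n "0\<^sub>m n 1" M'] M by simp
  qed
  have Z1: "Z 1 (1\<^sub>m n) = 1\<^sub>m (Suc n)"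
    by (rule eq_matI) (auto simp: Z_def)
  have ZU: "unitary_mat (Suc n) (Z 1 U)"
    using u by (intro unitary_matI) (auto simp: Z Z_adj Z_mult Z1)
  have diag: "mat_diag (Suc n) d' = Z e (mat_diag n d)"
    by (rule eq_matI) (auto simp: Z_def mat_diag_def d'_def split: nat.splits)
  have "Z 1 U * mat_diag (Suc n) d' * mat_adjoint (Z 1 U) = Z e C"
    using u square_mat_mult(1)[OF u(1), of "mat_diag n d"] by (simp add: Z_adj diag Z_mult CU)
  also have "\<dots> = B"
  proof (rule eq_matI)
    fix i j assume "i < dim_row B" "j < dim_col B"
    hence ij: "i < Suc n" "j < Suc n"
      using B by auto
    show "Z e C $$ (i, j) = B $$ (i, j)"
    proof (cases "j = 0")
      case True
      thus ?thesis
        using col0[OF ij(1)] ij by (simp add: Z_index[OF C])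
    next
      case False
      moreover have "B $$ (0, j) = 0"
        using col0[OF ij(2)] B_sym[of 0 j] ij False by simp
      moreover have "C $$ (i - 1, j - 1) = B $$ (i, j)" if "i \<noteq> 0"
        using that False ij by (simp add: C_def)
      ultimately show ?thesis
        using ij by (simp add: Z_index[OF C])
    qed
  qed (use B Z[OF C, of e] in auto)
  finally have BZ: "B = Z 1 U * mat_diag (Suc n) d' * mat_adjoint (Z 1 U)" ..
  note zu = unitary_matD[OF ZU]
  have "W * B * mat_adjoint W = A"
    using A w unitary_mat_cancel(2)[OF W A]
    by (simp add: B_def square_mat_mult[where n = "Suc n"])
  hence "A = (W * Z 1 U) * mat_diag (Suc n) d' * mat_adjoint (W * Z 1 U)"
    using w zu mat_diag_dim[of "Suc n" d'] unfolding BZ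
    by (simp add: mat_adjoint_mult[where n = "Suc n" and m = "Suc n" and k = "Suc n"] square_mat_mult[where n = "Suc n"])
  with unitary_mat_mult[OF W ZU] show ?case
    by blast
qed

section \<open>Trace, Frobenius norm and entrywise norm\<close>

definition mat_trace :: "complex mat \<Rightarrow> complex" where
  "mat_trace M = (\<Sum>i<dim_row M. M $$ (i, i))"

lemma mat_trace_mult:
  assumes "A \<in> carrier_mat n m" "B \<in> carrier_mat m n"
  shows "mat_trace (A * B) = (\<Sum>i<n. \<Sum>j<m. A $$ (i, j) * B $$ (j, i))"
  using assms by (auto simp: mat_trace_def scalar_prod_def atLeast0LessThan intro!: sum.cong)

lemma mat_trace_comm:
  assumes "A \<in> carrier_mat n m" "B \<in> carrier_mat m n"
  shows "mat_trace (A * B) = mat_trace (B * A)"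
proof -
  have "mat_trace (A * B) = (\<Sum>j<m. \<Sum>i<n. A $$ (i, j) * B $$ (j, i))"
    using mat_trace_mult[OF assms] sum.swap[of _ "{..<m}" "{..<n}"] by simp
  also have "\<dots> = mat_trace (B * A)"
    using mat_trace_mult[OF assms(2,1)] by (simp add: mult.commute)
  finally show ?thesis .
qed

lemma mat_trace_unitary_conj:
  assumes U: "unitary_mat n U" and M: "M \<in> carrier_mat n n"
  shows "mat_trace (mat_adjoint U * (M * U)) = mat_trace M"
proof -
  note u = unitary_matD[OF U]
  have "mat_trace (mat_adjoint U * (M * U)) = mat_trace (M * (U * mat_adjoint U))"
    using mat_trace_comm[of "mat_adjoint U" n n "M * U"] u M by (simp add: square_mat_mult[where n = n])
  thus ?thesis
    using u M by simp
qed

lemma cnj_mult_self: "cnj z * z = (complex_of_real (cmod z))\<^sup>2"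
  using complex_norm_square[of z] by (simp add: mult.commute)

lemma frobenius_norm_trace:
  assumes "M \<in> carrier_mat n n"
  shows "complex_of_real ((frobenius_norm M)\<^sup>2) = mat_trace (mat_adjoint M * M)"
proof -
  have "(frobenius_norm M)\<^sup>2 = (\<Sum>i<n. \<Sum>j<n. (cmod (M $$ (i, j)))\<^sup>2)"
    unfolding frobenius_norm_def using assms by (subst real_sqrt_pow2) (auto intro!: sum_nonneg)
  also have "\<dots> = (\<Sum>j<n. \<Sum>i<n. (cmod (M $$ (i, j)))\<^sup>2)"
    by (rule sum.swap)
  also have "complex_of_real \<dots> = mat_trace (mat_adjoint M * M)"
    unfolding mat_trace_mult[OF mat_adjoint_carrier[OF assms] assms]
    using assms by (auto simp: cnj_mult_self intro!: sum.cong)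
  finally show ?thesis .
qed

lemma frobenius_norm_nonneg: "frobenius_norm M \<ge> 0"
  by (auto simp: frobenius_norm_def intro!: sum_nonneg)

text \<open>The map sending \<open>A\<close> to \<open>F * A * F\<close> is not a conjugation, since
  \<open>F\<close> stands on both sides. In the product of an adjoint with a second such matrix,
  however, the inner pair cancels and a genuine unitary conjugation is left, which preserves
  traces.\<close>

lemma mat_adjoint_sandwich:
  assumes "unitary_mat n F" "A \<in> carrier_mat n n" "C \<in> carrier_mat n n"
  shows "mat_adjoint (F * A * F) * (F * C * F) = mat_adjoint F * (mat_adjoint A * C * F)"
proof -
  note f = unitary_matD[OF assms(1)]
  have "mat_adjoint (F * A * F) * (F * C * F)
      = mat_adjoint F * (mat_adjoint A * (mat_adjoint F * (F * (C * F))))"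
    using f(1,2) assms(2,3)
    by (simp add: mat_adjoint_mult[where n = n and m = n and k = n] square_mat_mult[where n = n])
  also have "\<dots> = mat_adjoint F * (mat_adjoint A * (C * F))"
    using unitary_mat_cancel(1)[OF assms(1), of "C * F" n] f(1) assms(3) by simp
  finally show ?thesis
    using f(1,2) assms(2,3) by (simp add: square_mat_mult[where n = n])
qed

lemma frobenius_norm_sandwich:
  assumes F: "unitary_mat n F" and A: "A \<in> carrier_mat n n"
  shows "frobenius_norm (F * A * F) = frobenius_norm A"
proof -
  note f = unitary_matD[OF F]
  have FAF: "F * A * F \<in> carrier_mat n n"
    using f(1) A by (simp add: square_mat_mult)
  have AA: "mat_adjoint A * A \<in> carrier_mat n n"
    using A by (simp add: square_mat_mult)
  have "complex_of_real ((frobenius_norm (F * A * F))\<^sup>2) = complex_of_real ((frobenius_norm A)\<^sup>2)"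
    unfolding frobenius_norm_trace[OF FAF] frobenius_norm_trace[OF A] mat_adjoint_sandwich[OF F A A]
    by (rule mat_trace_unitary_conj[OF F AA])
  hence "(frobenius_norm (F * A * F))\<^sup>2 = (frobenius_norm A)\<^sup>2"
    using of_real_eq_iff by blast
  thus ?thesis
    by (simp add: frobenius_norm_nonneg)
qed

section \<open>Column norms of unitary matrices and the equality case of the trace bound\<close>

lemma adjoint_mult_self_diag:
  assumes "M \<in> carrier_mat n m" "j < m"
  shows "(mat_adjoint M * M) $$ (j, j) = complex_of_real (\<Sum>i<n. (cmod (M $$ (i, j)))\<^sup>2)"
  using assms by (auto simp: scalar_prod_def atLeast0LessThan cnj_mult_self intro!: sum.cong)

lemma unitary_column_norm:
  assumes "unitary_mat n U" "j < n"
  shows "(\<Sum>i<n. (cmod (U $$ (i, j)))\<^sup>2) = 1"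
proof -
  note u = unitary_matD[OF assms(1)]
  have "complex_of_real (\<Sum>i<n. (cmod (U $$ (i, j)))\<^sup>2) = 1"
    using adjoint_mult_self_diag[OF u(1) assms(2)] assms(2) unfolding u(3) by simp
  thus ?thesis
    using of_real_eq_1_iff by blast
qed

lemma unitary_row_norm:
  assumes "unitary_mat n U" "i < n"
  shows "(\<Sum>j<n. (cmod (U $$ (i, j)))\<^sup>2) = 1"
  using unitary_column_norm[OF unitary_mat_adjoint[OF assms(1)] assms(2)] unitary_matD(1)[OF assms(1)] assms(2)
  by simp

text \<open>Two such entries would already contribute 2. It is applied to the moduli in a row or
  column of a unitary matrix.\<close>

lemma sum_squares_le_one_unique:
  fixes f :: "nat \<Rightarrow> real"
  assumes "(\<Sum>i<n. (f i)\<^sup>2) \<le> 1" "i < n" "j < n" "f i \<ge> 1" "f j \<ge> 1"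
  shows "i = j"
proof (rule ccontr)
  assume "i \<noteq> j"
  have "1 \<le> (f i)\<^sup>2" "1 \<le> (f j)\<^sup>2"
    using assms(4,5) by (simp_all add: one_le_power)
  hence "2 \<le> (\<Sum>k\<in>{i, j}. (f k)\<^sup>2)"
    using \<open>i \<noteq> j\<close> by simp
  also have "\<dots> \<le> (\<Sum>i<n. (f i)\<^sup>2)"
    using assms(2,3) by (intro sum_mono2) auto
  finally show False
    using assms(1) by simp
qed

text \<open>Zero rows and columns are allowed, in contrast to monomial matrices, because the
  adjacency matrix may be singular.\<close>

definition partial_monomial :: "complex mat \<Rightarrow> bool" where
  "partial_monomial B \<longleftrightarrow>
     (\<forall>i j k. i < dim_row B \<longrightarrow> j < dim_col B \<longrightarrow> k < dim_col B \<longrightarrow>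
        B $$ (i, j) \<noteq> 0 \<longrightarrow> B $$ (i, k) \<noteq> 0 \<longrightarrow> j = k) \<and>
     (\<forall>i j k. i < dim_row B \<longrightarrow> k < dim_row B \<longrightarrow> j < dim_col B \<longrightarrow>
        B $$ (i, j) \<noteq> 0 \<longrightarrow> B $$ (k, j) \<noteq> 0 \<longrightarrow> i = k)"

text \<open>Equality in \<open>tr (U\<^sup>* B) \<le> \<Sum> \<bar>U\<bar>\<bar>B\<bar> \<le> \<Sum> \<bar>B\<bar>\<close> forces the entries of \<open>U\<close> to have modulus one on
  the support of \<open>B\<close>, and each row and column of \<open>U\<close> has room for only one such entry.\<close>

lemma partial_monomial_if_trace_eq_l1:
  assumes U: "unitary_mat n U" and B: "B \<in> carrier_mat n n"
    and tr: "mat_trace (mat_adjoint U * B) = complex_of_real (l1_norm_mat B)"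
  shows "partial_monomial B"
proof -
  note u = unitary_matD[OF U]
  have le1: "cmod (U $$ (i, j)) \<le> 1" if "i < n" "j < n" for i j
  proof -
    have "(cmod (U $$ (i, j)))\<^sup>2 \<le> (\<Sum>i<n. (cmod (U $$ (i, j)))\<^sup>2)"
      using that by (intro member_le_sum) auto
    hence "(cmod (U $$ (i, j)))\<^sup>2 \<le> 1\<^sup>2"
      using unitary_column_norm[OF U that(2)] by simp
    thus ?thesis
      by (rule power2_le_imp_le) simp
  qed
  \<comment> \<open>\<open>h p\<close> is the slack at position \<open>p\<close> in the bound of the
    real part of the trace by the entrywise norm. The slacks are nonnegative and sum to 0, so each
    of them is 0.\<close>
  define h where "h p = cmod (B $$ p) - Re (cnj (U $$ p) * B $$ p)" for p
  have h_lower: "h (i, j) \<ge> (1 - cmod (U $$ (i, j))) * cmod (B $$ (i, j))" for i j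
    using complex_Re_le_cmod[of "cnj (U $$ (i, j)) * B $$ (i, j)"]
    by (simp add: h_def norm_mult algebra_simps)
  have h_nonneg: "h p \<ge> 0" if p: "p \<in> {..<n} \<times> {..<n}" for p
  proof -
    obtain i j where "p = (i, j)" "i < n" "j < n"
      using p by auto
    thus ?thesis
      using order_trans[OF _ h_lower[of i j]] le1[of i j] by simp
  qed
  have "mat_trace (mat_adjoint U * B) = (\<Sum>j<n. \<Sum>i<n. cnj (U $$ (i, j)) * B $$ (i, j))"
    unfolding mat_trace_mult[OF u(2) B] using u(1) by (auto intro!: sum.cong)
  also have "\<dots> = (\<Sum>i<n. \<Sum>j<n. cnj (U $$ (i, j)) * B $$ (i, j))"
    by (rule sum.swap)
  also have "\<dots> = (\<Sum>p\<in>{..<n} \<times> {..<n}. cnj (U $$ p) * B $$ p)"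
    by (simp add: sum.cartesian_product split_def)
  finally have "Re (\<Sum>p\<in>{..<n} \<times> {..<n}. cnj (U $$ p) * B $$ p) = l1_norm_mat B"
    using tr by (metis Re_complex_of_real)
  moreover have "l1_norm_mat B = (\<Sum>p\<in>{..<n} \<times> {..<n}. cmod (B $$ p))"
    using B by (simp add: l1_norm_mat_def sum.cartesian_product split_def)
  ultimately have "(\<Sum>p\<in>{..<n} \<times> {..<n}. h p) = 0"
    by (simp add: h_def sum_subtractf)
  hence h0: "h p = 0" if "p \<in> {..<n} \<times> {..<n}" for p
    using sum_nonneg_eq_0_iff[of "{..<n} \<times> {..<n}" h] h_nonneg that by auto
  \<comment> \<open>By \<open>h_lower\<close>, zero slack at a nonzero entry of \<open>B\<close>
    leaves no room for an entry of \<open>U\<close> of modulus below 1.\<close>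
  have ge1: "cmod (U $$ (i, j)) \<ge> 1" if "i < n" "j < n" "B $$ (i, j) \<noteq> 0" for i j
  proof -
    have "(1 - cmod (U $$ (i, j))) * cmod (B $$ (i, j)) \<le> 0"
      using h_lower[of i j] h0[of "(i, j)"] that by simp
    thus ?thesis
      using that(3) by (simp add: mult_le_0_iff)
  qed
  show ?thesis
    unfolding partial_monomial_def
  proof (intro conjI allI impI)
    fix i j k
    assume "i < dim_row B" "j < dim_col B" "k < dim_col B" "B $$ (i, j) \<noteq> 0" "B $$ (i, k) \<noteq> 0"
    thus "j = k"
      using ge1[of i j] ge1[of i k] B unitary_row_norm[OF U, of i]
      by (intro sum_squares_le_one_unique[of "\<lambda>j. cmod (U $$ (i, j))" n]) auto
  next
    fix i j k
    assume "i < dim_row B" "k < dim_row B" "j < dim_col B" "B $$ (i, j) \<noteq> 0" "B $$ (k, j) \<noteq> 0"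
    thus "i = k"
      using ge1[of i j] ge1[of k j] B unitary_column_norm[OF U, of j]
      by (intro sum_squares_le_one_unique[of "\<lambda>i. cmod (U $$ (i, j))" n]) auto
  qed
qed

section \<open>Spectrum and multiplicities read off from a unitary diagonalization\<close>

lemma char_poly_unitary_conj_diag:
  assumes U: "unitary_mat n U" and A: "A = U * mat_diag n d * mat_adjoint U"
  shows "char_poly A = (\<Prod>i<n. [:- d i, 1:])"
proof -
  note u = unitary_matD[OF U]
  have "A \<in> carrier_mat n n"
    unfolding A using u(1,2) by (intro square_mat_mult) auto
  hence "similar_mat A (mat_diag n d)"
    by (intro similar_matI[of _ _ U "mat_adjoint U" n]) (use u A in auto)
  hence "char_poly A = char_poly (mat_diag n d)"
    by (rule char_poly_similar)
  also have "\<dots> = (\<Prod>a\<leftarrow>diag_mat (mat_diag n d). [:- a, 1:])"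
    by (rule char_poly_upper_triangular[of _ n]) (auto simp: mat_diag_def)
  also have "diag_mat (mat_diag n d) = map d [0..<n]"
    by (auto simp: diag_mat_def mat_diag_def)
  also have "(\<Prod>a\<leftarrow>map d [0..<n]. [:- a, 1:]) = (\<Prod>i<n. [:- d i, 1:])"
    by (simp add: prod.distinct_set_conv_list[symmetric] atLeast0LessThan comp_def)
  finally show ?thesis .
qed

text \<open>Root orders add over products, and each linear factor contributes 1 or 0. Algebraic
  multiplicities thus become counts of diagonal indices.\<close>

lemma order_prod_linear:
  fixes d :: "nat \<Rightarrow> complex"
  shows "order \<mu> (\<Prod>i<n. [:- d i, 1:]) = card {i. i < n \<and> d i = \<mu>}"
proof (induction n)
  case (Suc n)
  have "(\<Prod>i<n. [:- d i, 1:]) * [:- d n, 1:] \<noteq> 0"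
    by (auto simp: prod_zero_iff simp del: mult_pCons_right)
  hence "order \<mu> (\<Prod>i<Suc n. [:- d i, 1:]) = card {i. i < n \<and> d i = \<mu>} + (if d n = \<mu> then 1 else 0)"
    using Suc by (simp add: order_mult order_linear' del: mult_pCons_right)
  also have "{i. i < Suc n \<and> d i = \<mu>} = (if d n = \<mu> then insert n {i. i < n \<and> d i = \<mu>} else {i. i < n \<and> d i = \<mu>})"
    by (auto simp: less_Suc_eq)
  hence "card {i. i < n \<and> d i = \<mu>} + (if d n = \<mu> then 1 else 0) = card {i. i < Suc n \<and> d i = \<mu>}"
    by simp
  finally show ?case .
qed simp

lemma spectrum_unitary_conj_diag:
  assumes U: "unitary_mat n U" and A: "A = U * mat_diag n d * mat_adjoint U"
  shows "spectrum A = d ` {..<n}"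
proof -
  note u = unitary_matD[OF U]
  have "A \<in> carrier_mat n n"
    unfolding A using u(1,2) by (intro square_mat_mult) auto
  hence "spectrum A = {k. \<exists>i<n. k - d i = 0}"
    by (simp add: spectrum_root_char_poly char_poly_unitary_conj_diag[OF assms] poly_prod prod_zero_iff Bex_def)
  thus ?thesis
    by auto
qed

text \<open>Grouping the indices \<open>i\<close> by the value \<open>d i\<close> gives both sides.
  With \<open>f = cmod\<close> this turns the graph energy into a sum over the diagonal.\<close>

lemma sum_spectrum_order:
  assumes U: "unitary_mat n U" and A: "A = U * mat_diag n d * mat_adjoint U"
  shows "(\<Sum>\<mu>\<in>spectrum A. real (order \<mu> (char_poly A)) * f \<mu>) = (\<Sum>i<n. f (d i))"
proof -
  have "(\<Sum>i<n. f (d i)) = (\<Sum>\<mu>\<in>d ` {..<n}. \<Sum>i\<in>{i \<in> {..<n}. d i = \<mu>}. f (d i))"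
    by (rule sum.image_gen) simp
  also have "\<dots> = (\<Sum>\<mu>\<in>spectrum A. real (order \<mu> (char_poly A)) * f \<mu>)"
    unfolding spectrum_unitary_conj_diag[OF assms] char_poly_unitary_conj_diag[OF assms] order_prod_linear
    by (intro sum.cong) auto
  finally show ?thesis ..
qed

section \<open>The Fourier matrix\<close>

lemma smult_square_mat_mult:
  fixes A B :: "complex mat"
  assumes "A \<in> carrier_mat n n" "B \<in> carrier_mat n n"
  shows "A * (c \<cdot>\<^sub>m B) = c \<cdot>\<^sub>m (A * B)" "(c \<cdot>\<^sub>m A) * B = c \<cdot>\<^sub>m (A * B)"
  using assms by auto

lemma fourier_mat_carrier [simp]: "fourier_mat N \<in> carrier_mat N N"
  by (simp add: fourier_mat_def)

lemma index_fourier_mat: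
  assumes "m < N" "x < N"
  shows "fourier_mat N $$ (m, x) = cis (- (2 * pi * m * x / N)) / sqrt N"
proof -
  have eq: "- 2 * complex_of_real pi * \<i> * of_nat m * of_nat x / of_nat N = \<i> * complex_of_real (- (2 * pi * m * x / N))"
    by (simp add: ac_simps)
  have "fourier_mat N $$ (m, x) = complex_of_real (1 / sqrt N)
      * exp (- 2 * complex_of_real pi * \<i> * of_nat m * of_nat x / of_nat N)"
    using assms by (simp add: fourier_mat_def)
  also have "\<dots> = cis (- (2 * pi * m * x / N)) / sqrt N"
    unfolding eq cis_conv_exp by simp
  finally show ?thesis .
qed

text \<open>A geometric sum whose base \<open>z\<close> satisfies \<open>z ^ N = 1\<close>; it
  vanishes as soon as \<open>z\<close> differs from 1.\<close>

lemma sum_cis_root_of_unity: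
  assumes "m < N" "k < N"
  shows "(\<Sum>x<N. cis (2 * pi * (real m - real k) / N) ^ x) = (if m = k then of_nat N else 0)"
proof (cases "m = k")
  case False
  define z where "z = cis (2 * pi * (real m - real k) / N)"
  have "z ^ N = cis (2 * pi * of_int (int m - int k))"
    using assms by (simp add: z_def DeMoivre)
  hence zN: "z ^ N = 1"
    using cis_multiple_2pi[of "of_int (int m - int k)"] by simp
  \<comment> \<open>If \<open>z = 1\<close>, then \<open>m - k\<close> would be a nonzero multiple
    of \<open>N\<close>, yet both indices lie below \<open>N\<close>.\<close>
  have "z \<noteq> 1"
  proof
    assume "z = 1"
    hence "cos (2 * pi * (real m - real k) / N) = 1"
      by (simp add: z_def complex_eq_iff)
    then obtain t :: int where "2 * pi * (real m - real k) / N = real_of_int t * 2 * pi"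
      using cos_one_2pi_int by blast
    hence "2 * pi * (real m - real k) = 2 * pi * (real_of_int t * real N)"
      using assms by (simp add: field_simps)
    hence "real m - real k = real_of_int t * real N"
      by (simp del: mult.assoc)
    hence "real_of_int (int m - int k) = real_of_int (t * int N)"
      by simp
    hence "int m - int k = t * int N"
      using of_int_eq_iff by blast
    moreover from this False have "t \<noteq> 0" by auto
    hence "1 \<le> \<bar>t\<bar>" by simp
    hence "int N \<le> \<bar>t * int N\<bar>"
      using mult_right_mono[of 1 "\<bar>t\<bar>" "int N"] by (simp add: abs_mult)
    ultimately show False
      using assms by linarith
  qed
  thus ?thesis
    using one_diff_power_eq[of z N] zN False by (simp add: z_def)
qed simp

lemma unitary_fourier_mat: "unitary_mat N (fourier_mat N)"
proof (rule unitary_matI)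
  show "mat_adjoint (fourier_mat N) * fourier_mat N = 1\<^sub>m N"
  proof (rule eq_matI)
    fix m k assume "m < dim_row (1\<^sub>m N)" "k < dim_col (1\<^sub>m N)"
    hence mk: "m < N" "k < N" by auto
    have entry: "cnj (fourier_mat N $$ (x, m)) * fourier_mat N $$ (x, k)
        = cis (2 * pi * (real m - real k) / N) ^ x / of_nat N" if x: "x < N" for x
    proof -
      have sq: "complex_of_real (sqrt N) * complex_of_real (sqrt N) = of_nat N"
        by (simp flip: of_real_mult)
      have "cnj (fourier_mat N $$ (x, m)) * fourier_mat N $$ (x, k)
          = cis (2 * pi * x * m / N) * cis (- (2 * pi * x * k / N)) / (complex_of_real (sqrt N) * complex_of_real (sqrt N))"
        unfolding index_fourier_mat[OF x mk(1)] index_fourier_mat[OF x mk(2)]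
        by (simp add: cis_cnj)
      also have "\<dots> = cis (2 * pi * x * m / N + - (2 * pi * x * k / N)) / of_nat N"
        unfolding sq cis_mult ..
      also have "2 * pi * x * m / N + - (2 * pi * x * k / N) = x * (2 * pi * (real m - real k) / N)"
        by (simp add: algebra_simps diff_divide_distrib)
      finally show ?thesis
        unfolding DeMoivre .
    qed
    have "(mat_adjoint (fourier_mat N) * fourier_mat N) $$ (m, k)
        = (\<Sum>x<N. cis (2 * pi * (real m - real k) / N) ^ x / of_nat N)"
      using mk fourier_mat_carrier[of N] entry
      by (auto simp: scalar_prod_def atLeast0LessThan simp del: fourier_mat_carrier intro!: sum.cong)
    also have "\<dots> = (if m = k then 1 else 0)"
      using mk sum_cis_root_of_unity[OF mk] by (simp flip: sum_divide_distrib)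
    finally show "(mat_adjoint (fourier_mat N) * fourier_mat N) $$ (m, k) = 1\<^sub>m N $$ (m, k)"
      using mk by simp
  qed (simp_all add: fourier_mat_def)
qed simp

section \<open>Projectors onto eigenspaces\<close>

text \<open>An explicit formula for the projector, in terms of \<open>U\<close> and \<open>d\<close>
  instead of the matrix. Two matrices diagonalized by the same \<open>U\<close> can therefore share
  a projector, as the adjacency and Laplacian matrices of a regular graph do.\<close>

definition eigenprojector :: "nat \<Rightarrow> complex mat \<Rightarrow> (nat \<Rightarrow> complex) \<Rightarrow> complex \<Rightarrow> complex mat" where
  "eigenprojector n U d \<mu> = U * mat_diag n (\<lambda>i. if d i = \<mu> then 1 else 0) * mat_adjoint U"

text \<open>The main proof interprets this twice with the same \<open>U\<close>, for the adjacency
  matrix and for the Laplacian.\<close>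

locale unitary_diagonalization =
  fixes n :: nat and U A :: "complex mat" and d :: "nat \<Rightarrow> complex"
  assumes U: "unitary_mat n U" and A: "A = U * mat_diag n d * mat_adjoint U"
begin

lemma carrier_U [simp]: "U \<in> carrier_mat n n" "mat_adjoint U \<in> carrier_mat n n"
  using unitary_matD[OF U] by auto

lemma conj_diag_mult:
  "(U * mat_diag n f * mat_adjoint U) * (U * mat_diag n g * mat_adjoint U)
    = U * mat_diag n (\<lambda>i. f i * g i) * mat_adjoint U"
proof -
  have "(U * mat_diag n f * mat_adjoint U) * (U * mat_diag n g * mat_adjoint U)
      = U * (mat_diag n f * (mat_adjoint U * (U * (mat_diag n g * mat_adjoint U))))"
    by (simp add: square_mat_mult[where n = n])
  also have "\<dots> = U * (mat_diag n f * (mat_diag n g * mat_adjoint U))"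
    using unitary_mat_cancel(1)[OF U, of "mat_diag n g * mat_adjoint U" n] by (simp add: square_mat_mult)
  also have "\<dots> = U * (mat_diag n f * mat_diag n g * mat_adjoint U)"
    by (simp add: square_mat_mult[where n = n] del: mat_diag_diag)
  finally show ?thesis
    by (simp add: square_mat_mult[where n = n])
qed

lemma conj_diag_adjoint:
  "mat_adjoint (U * mat_diag n f * mat_adjoint U) = U * mat_diag n (\<lambda>i. cnj (f i)) * mat_adjoint U"
  by (simp add: mat_adjoint_mult[where n = n and m = n and k = n] square_mat_mult[where n = n] mat_adjoint_mat_diag)

lemma conj_diag_carrier [simp]: "U * mat_diag n f * mat_adjoint U \<in> carrier_mat n n"
  by (simp add: square_mat_mult)

lemma conj_diag_trace: "mat_trace (U * mat_diag n f * mat_adjoint U) = (\<Sum>i<n. f i)"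
proof -
  have "mat_trace (U * mat_diag n f * mat_adjoint U) = mat_trace (mat_adjoint (mat_adjoint U) * (mat_diag n f * mat_adjoint U))"
    by (simp add: square_mat_mult[where n = n])
  also have "\<dots> = mat_trace (mat_diag n f)"
    by (rule mat_trace_unitary_conj[OF unitary_mat_adjoint[OF U]]) simp
  also have "\<dots> = (\<Sum>i<n. f i)"
    by (simp add: mat_trace_def mat_diag_def)
  finally show ?thesis .
qed

lemma carrier_A [simp]: "A \<in> carrier_mat n n"
  by (simp add: A)

lemma eigenprojector_carrier [simp]: "eigenprojector n U d \<mu> \<in> carrier_mat n n"
  by (simp add: eigenprojector_def)

lemma eigenprojector_dim [simp]:
  "dim_row (eigenprojector n U d \<mu>) = n" "dim_col (eigenprojector n U d \<mu>) = n"
  using carrier_matD[OF eigenprojector_carrier] by auto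

lemma eigenprojector_adjoint: "mat_adjoint (eigenprojector n U d \<mu>) = eigenprojector n U d \<mu>"
proof -
  have "(\<lambda>i. cnj (if d i = \<mu> then 1 else 0)) = (\<lambda>i. if d i = \<mu> then 1 else 0)"
    by auto
  thus ?thesis
    unfolding eigenprojector_def conj_diag_adjoint by simp
qed

lemma eigenprojector_idem: "eigenprojector n U d \<mu> * eigenprojector n U d \<mu> = eigenprojector n U d \<mu>"
proof -
  have "(\<lambda>i. (if d i = \<mu> then 1 else 0) * (if d i = \<mu> then 1 else 0)) = (\<lambda>i. if d i = \<mu> then 1 else (0 :: complex))"
    by auto
  thus ?thesis
    unfolding eigenprojector_def conj_diag_mult by simp
qed

text \<open>The trace counts the indices with \<open>d i = \<mu>\<close>, which is also the order of
  the root \<mu>. This links the rank of the projector to the multiplicity.\<close>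

lemma eigenprojector_trace: "mat_trace (eigenprojector n U d \<mu>) = of_nat (order \<mu> (char_poly A))"
proof -
  have "{..<n} \<inter> {i. d i = \<mu>} = {i. i < n \<and> d i = \<mu>}" by auto
  thus ?thesis
    by (simp add: eigenprojector_def conj_diag_trace char_poly_unitary_conj_diag[OF U A] order_prod_linear sum.If_cases)
qed

lemma mult_eigenprojector: "A * eigenprojector n U d \<mu> = \<mu> \<cdot>\<^sub>m eigenprojector n U d \<mu>"
proof -
  have "A * eigenprojector n U d \<mu> = U * mat_diag n (\<lambda>i. \<mu> * (if d i = \<mu> then 1 else 0)) * mat_adjoint U"
  proof -
    have "(\<lambda>i. d i * (if d i = \<mu> then 1 else 0)) = (\<lambda>i. \<mu> * (if d i = \<mu> then 1 else 0))"
      by auto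
    thus ?thesis
      unfolding eigenprojector_def A conj_diag_mult by simp
  qed
  also have "mat_diag n (\<lambda>i. \<mu> * (if d i = \<mu> then 1 else 0)) = \<mu> \<cdot>\<^sub>m mat_diag n (\<lambda>i. if d i = \<mu> then 1 else 0)"
    by (rule eq_matI) (auto simp: mat_diag_def)
  also have "U * \<dots> * mat_adjoint U = \<mu> \<cdot>\<^sub>m eigenprojector n U d \<mu>"
    by (simp add: eigenprojector_def smult_square_mat_mult[where n = n] square_mat_mult)
  finally show ?thesis .
qed

text \<open>In the coordinates \<open>Y\<close> given by \<open>U\<close>, the equation says
  \<open>d i * Y $$ (i, j) = \<mu> * Y $$ (i, j)\<close>, so only rows with
  \<open>d i = \<mu>\<close> survive, and the projector keeps exactly these. The width
  \<open>m\<close> covers single vectors as well as square matrices.\<close>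

lemma eigenprojector_fixes:
  assumes M: "M \<in> carrier_mat n m" and AM: "A * M = \<mu> \<cdot>\<^sub>m M"
  shows "eigenprojector n U d \<mu> * M = M"
proof -
  define Y where "Y = mat_adjoint U * M"
  have Y: "Y \<in> carrier_mat n m"
    using M by (simp add: Y_def mult_carrier_mat[OF carrier_U(2)])
  have UY: "U * Y = M"
    using unitary_mat_cancel(2)[OF U M] by (simp add: Y_def)
  have conj: "(U * mat_diag n f * mat_adjoint U) * M = U * (mat_diag n f * Y)" for f
    unfolding Y_def using M
    by (simp add: assoc_mult_mat[of _ n n _ n _ m] square_mat_mult[where n = n] mult_carrier_mat[of _ n n _ m])
  have "mat_diag n d * Y = mat_adjoint U * (U * (mat_diag n d * Y))"
    using Y unitary_mat_cancel(1)[OF U, of "mat_diag n d * Y" m] by (simp add: mult_carrier_mat[of _ n n _ m])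
  also have "U * (mat_diag n d * Y) = \<mu> \<cdot>\<^sub>m M"
    using conj[of d] AM A by simp
  also have "mat_adjoint U * \<dots> = \<mu> \<cdot>\<^sub>m Y"
    unfolding Y_def by (rule mult_smult_distrib[OF carrier_U(2) M])
  finally have DY: "mat_diag n d * Y = \<mu> \<cdot>\<^sub>m Y" .
  have "mat_diag n (\<lambda>i. if d i = \<mu> then 1 else 0) * Y = Y"
  proof (rule eq_matI)
    fix i j assume ij: "i < dim_row Y" "j < dim_col Y"
    hence "d i * Y $$ (i, j) = \<mu> * Y $$ (i, j)"
      using arg_cong[OF DY, of "\<lambda>M. M $$ (i, j)"] Y by (simp add: mat_diag_mult_left[OF Y])
    thus "(mat_diag n (\<lambda>i. if d i = \<mu> then 1 else 0) * Y) $$ (i, j) = Y $$ (i, j)"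
      using ij Y by (auto simp: mat_diag_mult_left[OF Y])
  qed (use Y in \<open>auto simp: mat_diag_def\<close>)
  thus ?thesis
    by (simp add: eigenprojector_def conj UY)
qed

lemma eigenprojector_fixes_vec:
  assumes v: "v \<in> carrier_vec n" and Av: "A *\<^sub>v v = \<mu> \<cdot>\<^sub>v v"
  shows "eigenprojector n U d \<mu> *\<^sub>v v = v"
proof -
  define M where "M = mat_of_cols n [v]"
  have M: "M \<in> carrier_mat n 1" "col M 0 = v"
    using v by (auto simp: M_def)
  have M_index: "M $$ (i, 0) = v $ i" if "i < n" for i
    using that by (simp add: M_def mat_of_cols_def)
  have col_mult: "col (B * M) 0 = B *\<^sub>v v" if "B \<in> carrier_mat n n" for B
    using col_mult2[OF that M(1), of 0] M(2) by simp
  have "A * M = \<mu> \<cdot>\<^sub>m M"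
  proof (rule eq_matI)
    fix i j assume "i < dim_row (\<mu> \<cdot>\<^sub>m M)" "j < dim_col (\<mu> \<cdot>\<^sub>m M)"
    hence i: "i < n" and j: "j = 0" using M by auto
    have "(A * M) $$ (i, 0) = (A *\<^sub>v v) $ i"
      using i M carrier_matD[OF carrier_A] by simp
    also have "\<dots> = \<mu> * v $ i"
      using i v unfolding Av by simp
    finally show "(A * M) $$ (i, j) = (\<mu> \<cdot>\<^sub>m M) $$ (i, j)"
      unfolding j using i M(1) by (simp add: M_index del: index_mult_mat(1))
  qed (use M carrier_matD[OF carrier_A] in auto)
  from eigenprojector_fixes[OF M(1) this] show ?thesis
    using col_mult[OF eigenprojector_carrier] M(2) by metis
qed

text \<open>Existence: the explicit projector is self-adjoint and idempotent, maps into the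
  eigenspace and fixes it. Uniqueness makes the definite description refer to it.\<close>

lemma orthogonal_projector_eigenspace:
  "orthogonal_projector n (eigenspace A \<mu>) = eigenprojector n U d \<mu>"
proof -
  let ?P = "eigenprojector n U d \<mu>"
  have dim_A: "dim_row A = n"
    using carrier_A by blast
  have P_in: "?P *\<^sub>v v \<in> eigenspace A \<mu>" if v: "v \<in> carrier_vec n" for v
  proof -
    have "A *\<^sub>v (?P *\<^sub>v v) = (A * ?P) *\<^sub>v v"
      using v by (simp add: assoc_mult_mat_vec[of _ n n _ n])
    also have "\<dots> = \<mu> \<cdot>\<^sub>v (?P *\<^sub>v v)"
      unfolding mult_eigenprojector using v eigenprojector_carrier[of \<mu>]
      by (intro eq_vecI) (auto simp: scalar_prod_def sum_distrib_left mult.assoc intro!: sum.cong)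
    finally show ?thesis
      using mult_mat_vec_carrier[OF eigenprojector_carrier v] by (simp add: eigenspace_def dim_A)
  qed
  have orth: "(v - ?P *\<^sub>v v) \<bullet>c w = 0" if v: "v \<in> carrier_vec n" and w: "w \<in> eigenspace A \<mu>" for v w
  proof -
    have w': "w \<in> carrier_vec n" "?P *\<^sub>v w = w"
      using w eigenprojector_fixes_vec by (auto simp: eigenspace_def dim_A)
    have Pv: "?P *\<^sub>v v \<in> carrier_vec n"
      using v mult_mat_vec_carrier[OF eigenprojector_carrier] by blast
    have "(v - ?P *\<^sub>v v) \<bullet>c w = (v - ?P *\<^sub>v v) \<bullet>c (?P *\<^sub>v w)"
      using w' by simp
    also have "\<dots> = (?P *\<^sub>v (v - ?P *\<^sub>v v)) \<bullet>c w"
      using adjoint_cscalar_prod[of ?P n n "v - ?P *\<^sub>v v" w] v Pv w' by (simp add: eigenprojector_adjoint)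
    also have "?P *\<^sub>v (v - ?P *\<^sub>v v) = ?P *\<^sub>v v - (?P * ?P) *\<^sub>v v"
      using v Pv by (simp add: mult_minus_distrib_mat_vec[of _ n n] assoc_mult_mat_vec[of _ n n _ n])
    also have "\<dots> = 0\<^sub>v n"
      using Pv by (simp add: eigenprojector_idem)
    finally show ?thesis
      using w' by simp
  qed
  have is_proj: "is_orthogonal_projector n (eigenspace A \<mu>) ?P"
    unfolding is_orthogonal_projector_def using P_in orth by simp
  have "Q = ?P" if Q: "is_orthogonal_projector n (eigenspace A \<mu>) Q" for Q
  proof -
    have Qc: "Q \<in> carrier_mat n n"
      using Q by (simp add: is_orthogonal_projector_def)
    have "Q *\<^sub>v v = ?P *\<^sub>v v" if v: "v \<in> carrier_vec n" for v
    proof -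
      define x where "x = Q *\<^sub>v v"
      define y where "y = ?P *\<^sub>v v"
      have x: "x \<in> eigenspace A \<mu>" and y: "y \<in> eigenspace A \<mu>"
        using Q P_in v by (auto simp: is_orthogonal_projector_def x_def y_def)
      hence xy: "x \<in> carrier_vec n" "y \<in> carrier_vec n"
        by (auto simp: eigenspace_def dim_A)
      \<comment> \<open>The difference of two projections of \<open>v\<close> lies in the
        eigenspace, while both residuals are orthogonal to the eigenspace. Hence
        \<open>x - y\<close> is orthogonal to itself.\<close>
      have w: "x - y \<in> eigenspace A \<mu>"
      proof -
        have "A *\<^sub>v (x - y) = \<mu> \<cdot>\<^sub>v x - \<mu> \<cdot>\<^sub>v y"
          using x y xy mult_minus_distrib_mat_vec[OF carrier_A xy] by (simp add: eigenspace_def)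
        also have "\<dots> = \<mu> \<cdot>\<^sub>v (x - y)"
          using xy by (intro eq_vecI) (auto simp: algebra_simps)
        finally show ?thesis
          using xy by (simp add: eigenspace_def dim_A)
      qed
      have "(v - x) \<bullet>c (x - y) = 0" "(v - y) \<bullet>c (x - y) = 0"
        using Q orth[OF v w] v w by (auto simp: is_orthogonal_projector_def x_def y_def)
      moreover have "x - y = (v - y) - (v - x)"
        using v xy by (intro eq_vecI) auto
      hence "(x - y) \<bullet>c (x - y) = (v - y) \<bullet>c (x - y) - (v - x) \<bullet>c (x - y)"
        using minus_scalar_prod_distrib[of "v - y" n "v - x" "conjugate (x - y)"] v xy by simp
      ultimately have "(x - y) \<bullet>c (x - y) = 0"
        by simp
      hence diff: "x - y = 0\<^sub>v n"
        using conjugate_square_eq_0_vec[of "x - y" n] xy by simp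
      have "x $ i = y $ i" if "i < n" for i
        using arg_cong[OF diff, of "\<lambda>v. v $ i"] xy that by simp
      thus ?thesis
        using xy unfolding x_def[symmetric] y_def[symmetric] by (intro eq_vecI) auto
    qed
    hence eq: "Q *\<^sub>v unit_vec n j = ?P *\<^sub>v unit_vec n j" for j
      by simp
    have entry: "M $$ (i, j) = (M *\<^sub>v unit_vec n j) $ i" if "M \<in> carrier_mat n n" "i < n" "j < n" for M :: "complex mat" and i j
      using that by simp
    show ?thesis
    proof (rule eq_matI)
      fix i j assume "i < dim_row ?P" "j < dim_col ?P"
      hence ij: "i < n" "j < n"
        using eigenprojector_carrier[of \<mu>] by auto
      show "Q $$ (i, j) = ?P $$ (i, j)"
        unfolding entry[OF Qc ij] entry[OF eigenprojector_carrier ij] eq ..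
    qed (use Qc eigenprojector_carrier[of \<mu>] in auto)
  qed
  thus ?thesis
    unfolding orthogonal_projector_def using is_proj by (intro the_equality)
qed

end

section \<open>Fourier ratios of projectors\<close>

lemma frobenius_norm_projector:
  assumes P: "P \<in> carrier_mat n n" "mat_adjoint P = P" "P * P = P"
    and tr: "mat_trace P = of_nat m"
  shows "frobenius_norm P = sqrt m"
proof -
  have "complex_of_real ((frobenius_norm P)\<^sup>2) = complex_of_real (real m)"
    using frobenius_norm_trace[OF P(1)] P(2,3) tr by simp
  hence "(frobenius_norm P)\<^sup>2 = m"
    using of_real_eq_iff by blast
  thus ?thesis
    by (intro real_sqrt_unique[symmetric] frobenius_norm_nonneg)
qed

text \<open>With \<open>G = F * P * F\<close>, the matrix \<open>Q = mat_adjoint G * G\<close> is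
  again an orthogonal projector. Its diagonal entry \<open>q\<close> is the squared length of column
  \<open>j\<close> of \<open>G\<close>, and also that of column \<open>j\<close> of
  \<open>Q\<close>, which is at least \<open>q * q\<close>; so \<open>q\<close> is at most
  1.\<close>

lemma cmod_projector_sandwich_le_1:
  assumes F: "unitary_mat n F" and P: "P \<in> carrier_mat n n" "mat_adjoint P = P" "P * P = P"
    and ij: "i < n" "j < n"
  shows "cmod ((F * P * F) $$ (i, j)) \<le> 1"
proof -
  note f = unitary_matD[OF F]
  define G where "G = F * P * F"
  define Q where "Q = mat_adjoint F * (P * F)"
  have G: "G \<in> carrier_mat n n" and Q: "Q \<in> carrier_mat n n"
    using f(1,2) P(1) by (simp_all add: G_def Q_def square_mat_mult)
  have "mat_adjoint Q = Q"
    using f(1,2) P(1,2)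
    by (simp add: Q_def mat_adjoint_mult[where n = n and m = n and k = n] square_mat_mult[where n = n])
  moreover have "Q * Q = Q"
  proof -
    have "Q * Q = mat_adjoint F * (P * (F * (mat_adjoint F * (P * F))))"
      using f(1,2) P(1) by (simp add: Q_def square_mat_mult[where n = n])
    also have "\<dots> = mat_adjoint F * (P * (P * F))"
      using unitary_mat_cancel(2)[OF F, of "P * F" n] f(1) P(1) by (simp add: square_mat_mult)
    also have "\<dots> = mat_adjoint F * (P * P * F)"
      using f(1) P(1) square_mat_mult(2)[of P n P F] by simp
    finally show ?thesis
      by (simp add: Q_def P(3))
  qed
  ultimately have "Q $$ (j, j) = (mat_adjoint Q * Q) $$ (j, j)"
    by simp
  define q where "q = (\<Sum>k<n. (cmod (Q $$ (k, j)))\<^sup>2)"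
  have Qjj: "Q $$ (j, j) = complex_of_real q"
    using \<open>Q $$ (j, j) = _\<close> adjoint_mult_self_diag[OF Q ij(2)] by (simp add: q_def)
  have "(cmod (Q $$ (j, j)))\<^sup>2 \<le> q"
    unfolding q_def using ij by (intro member_le_sum[of j _ "\<lambda>k. (cmod (Q $$ (k, j)))\<^sup>2"]) auto
  hence "q * q \<le> q"
    by (simp add: Qjj power2_eq_square)
  hence q1: "q \<le> 1"
  proof -
    have "\<not> 1 < q"
      using \<open>q * q \<le> q\<close> mult_strict_left_mono[of 1 q q] by auto
    thus ?thesis by simp
  qed
  have "mat_adjoint G * G = Q"
    using mat_adjoint_sandwich[OF F P(1) P(1)] P(2,3) by (simp add: G_def Q_def)
  hence "complex_of_real (\<Sum>i<n. (cmod (G $$ (i, j)))\<^sup>2) = complex_of_real q"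
    using adjoint_mult_self_diag[OF G ij(2)] Qjj by simp
  hence "(\<Sum>i<n. (cmod (G $$ (i, j)))\<^sup>2) = q"
    using of_real_eq_iff by blast
  moreover have "(cmod (G $$ (i, j)))\<^sup>2 \<le> (\<Sum>i<n. (cmod (G $$ (i, j)))\<^sup>2)"
    using ij by (intro member_le_sum) auto
  ultimately have "(cmod (G $$ (i, j)))\<^sup>2 \<le> 1\<^sup>2"
    using q1 by simp
  thus ?thesis
    unfolding G_def by (rule power2_le_imp_le) simp
qed

lemma frobenius_norm_square:
  "(frobenius_norm M)\<^sup>2 = (\<Sum>i<dim_row M. \<Sum>j<dim_col M. (cmod (M $$ (i, j)))\<^sup>2)"
  unfolding frobenius_norm_def by (subst real_sqrt_pow2) (auto intro!: sum_nonneg)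

lemma fourier_ratio_unitary:
  assumes "M \<in> carrier_mat n n"
  shows "fourier_ratio M = l1_norm_mat (fourier_mat n * M * fourier_mat n) / frobenius_norm M"
  using assms frobenius_norm_sandwich[OF unitary_fourier_mat assms] by (simp add: fourier_ratio_def Let_def)

text \<open>Numbers in the unit interval dominate their squares, so the entrywise norm is at least
  the squared Frobenius norm \<open>m\<close>; divide by the Frobenius norm.\<close>

lemma fourier_ratio_projector_ge:
  assumes P: "P \<in> carrier_mat n n" "mat_adjoint P = P" "P * P = P"
    and tr: "mat_trace P = of_nat m"
  shows "fourier_ratio P \<ge> sqrt m"
proof -
  let ?G = "fourier_mat n * P * fourier_mat n"
  have G: "?G \<in> carrier_mat n n"
    using P(1) by (simp add: square_mat_mult)
  have frob: "frobenius_norm ?G = sqrt m"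
    using frobenius_norm_sandwich[OF unitary_fourier_mat P(1)] frobenius_norm_projector[OF assms] by simp
  have "real m = (frobenius_norm ?G)\<^sup>2"
    by (simp add: frob)
  also have "\<dots> \<le> l1_norm_mat ?G"
    unfolding frobenius_norm_square l1_norm_mat_def
  proof (intro sum_mono)
    fix i j assume "i \<in> {..<dim_row ?G}" "j \<in> {..<dim_col ?G}"
    hence "cmod (?G $$ (i, j)) \<le> 1"
      using carrier_matD[OF G] by (intro cmod_projector_sandwich_le_1[OF unitary_fourier_mat P]) simp_all
    thus "(cmod (?G $$ (i, j)))\<^sup>2 \<le> cmod (?G $$ (i, j))"
      by (simp add: power2_eq_square mult_left_le)
  qed
  \<comment> \<open>For \<open>m = 0\<close> both quotients are 0 by the convention on division, in
    agreement with \<open>sqrt m = 0\<close>.\<close>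
  finally have "real m / sqrt m \<le> l1_norm_mat ?G / sqrt m"
    by (rule divide_right_mono) simp
  thus ?thesis
    using fourier_ratio_unitary[OF P(1)] frobenius_norm_projector[OF assms] by (simp add: real_div_sqrt)
qed

lemma fourier_ratio_projector_eq:
  assumes P: "P \<in> carrier_mat n n" "mat_adjoint P = P" "P * P = P"
    and tr: "mat_trace P = of_nat m"
    and entries: "\<And>i j. i < n \<Longrightarrow> j < n \<Longrightarrow>
      cmod ((fourier_mat n * P * fourier_mat n) $$ (i, j)) \<in> {0, 1}"
  shows "fourier_ratio P = sqrt m"
proof -
  let ?G = "fourier_mat n * P * fourier_mat n"
  have G: "?G \<in> carrier_mat n n"
    using P(1) by (simp add: square_mat_mult)
  have "l1_norm_mat ?G = (frobenius_norm ?G)\<^sup>2"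
    unfolding frobenius_norm_square l1_norm_mat_def
  proof (intro sum.cong refl)
    fix i j assume "i \<in> {..<dim_row ?G}" "j \<in> {..<dim_col ?G}"
    hence "cmod (?G $$ (i, j)) \<in> {0, 1}"
      using carrier_matD[OF G] by (intro entries) simp_all
    thus "cmod (?G $$ (i, j)) = (cmod (?G $$ (i, j)))\<^sup>2"
      by auto
  qed
  also have "frobenius_norm ?G = sqrt m"
    using frobenius_norm_sandwich[OF unitary_fourier_mat P(1)] frobenius_norm_projector[OF assms(1-4)] by simp
  finally show ?thesis
    using fourier_ratio_unitary[OF P(1)] frobenius_norm_projector[OF assms(1-4)] by (simp add: real_div_sqrt)
qed

section \<open>Eigenprojectors of a matrix whose two-sided Fourier transform is partially
  monomial\<close>

lemma partial_monomialD:
  assumes "partial_monomial B" "B \<in> carrier_mat n m" "B $$ (i, j) \<noteq> 0"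
  shows "i < n \<Longrightarrow> j < m \<Longrightarrow> k < m \<Longrightarrow> k \<noteq> j \<Longrightarrow> B $$ (i, k) = 0"
    and "i < n \<Longrightarrow> j < m \<Longrightarrow> k < n \<Longrightarrow> k \<noteq> i \<Longrightarrow> B $$ (k, j) = 0"
  using assms(1,3) unfolding partial_monomial_def carrier_matD[OF assms(2)] by blast+

lemma smult_smult_mat: "a \<cdot>\<^sub>m (b \<cdot>\<^sub>m M) = (a * b) \<cdot>\<^sub>m (M :: complex mat)"
  by (rule eq_matI) auto

context unitary_diagonalization
begin

text \<open>With \<open>B = F A F\<close> and \<open>Q = F\<^sup>* P F\<close> one has \<open>\<mu> F P F = B Q\<close>. Since \<open>B\<^sup>* B = F\<^sup>* A\<^sup>2 F\<close> is diagonal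
  and the \<open>\<mu>\<^sup>2\<close>-eigenspace of \<open>A\<^sup>2\<close> is the \<open>\<mu>\<close>-eigenspace of \<open>A\<close>, the projector \<open>Q\<close> is the diagonal
  0-1 matrix that selects the columns of \<open>B\<close> whose nonzero entry has modulus \<open>\<bar>\<mu>\<bar>\<close>.\<close>

lemma cmod_eigenprojector_sandwich:
  assumes F: "unitary_mat n F" and herm: "mat_adjoint A = A"
    and mono: "partial_monomial (F * A * F)"
    and \<mu>: "\<mu> \<noteq> 0" "\<And>i. i < n \<Longrightarrow> d i \<noteq> - \<mu>"
    and ij: "i < n" "j < n"
  shows "cmod ((F * eigenprojector n U d \<mu> * F) $$ (i, j)) \<in> {0, 1}"
proof -
  note f = unitary_matD[OF F]
  let ?P = "eigenprojector n U d \<mu>"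
  define B where "B = F * A * F"
  define Q where "Q = mat_adjoint F * (?P * F)"
  \<comment> \<open>\<open>\<delta> j\<close> is the squared length of column \<open>j\<close> of
    \<open>B\<close>. The 0-1 matrix \<open>S\<close> selects the columns of squared length
    \<open>\<mu>\<^sup>2\<close>, and the goal is \<open>Q = S\<close>.\<close>
  define \<delta> where "\<delta> j = complex_of_real (\<Sum>i<n. (cmod (B $$ (i, j)))\<^sup>2)" for j
  define S where "S = mat_diag n (\<lambda>j. if \<delta> j = \<mu>\<^sup>2 then 1 else 0 :: complex)"
  have B: "B \<in> carrier_mat n n" and Q: "Q \<in> carrier_mat n n" and S: "S \<in> carrier_mat n n"
    using f(1,2) by (simp_all add: B_def Q_def S_def square_mat_mult)
  have BB_diag: "mat_adjoint B * B = mat_diag n \<delta>"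
  proof (rule eq_matI)
    fix i j assume "i < dim_row (mat_diag n \<delta>)" "j < dim_col (mat_diag n \<delta>)"
    hence ij: "i < n" "j < n" by (auto simp: mat_diag_def)
    show "(mat_adjoint B * B) $$ (i, j) = mat_diag n \<delta> $$ (i, j)"
    proof (cases "i = j")
      case True
      thus ?thesis
        using adjoint_mult_self_diag[OF B ij(2)] ij by (simp add: mat_diag_def \<delta>_def)
    next
      case False
      \<comment> \<open>Two distinct columns of \<open>B\<close> never have nonzero entries in the
        same row.\<close>
      have "cnj (B $$ (k, i)) * B $$ (k, j) = 0" if "k < n" for k
        using mono that False ij B by (auto simp: partial_monomial_def B_def[symmetric])
      thus ?thesis
        using False ij B by (auto simp: mat_diag_def scalar_prod_def intro!: sum.neutral)
    qed
  qed (use B in \<open>auto simp: mat_diag_def\<close>)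
  have BB: "mat_adjoint B * B = mat_adjoint F * (A * (A * F))"
    using mat_adjoint_sandwich[OF F carrier_A carrier_A] f(1) herm by (simp add: B_def square_mat_mult[where n = n])
  have AAF: "A * (A * F) = F * mat_diag n \<delta>"
    using unitary_mat_cancel(2)[OF F, of "A * (A * F)" n] f(1) BB BB_diag by (simp add: square_mat_mult)
  have Q_adj: "mat_adjoint Q = Q"
    using f(1,2) eigenprojector_adjoint[of \<mu>]
    by (simp add: Q_def mat_adjoint_mult[where n = n and m = n and k = n] square_mat_mult[where n = n])
  have FQ: "F * Q = ?P * F"
    using unitary_mat_cancel(2)[OF F, of "?P * F" n] f(1) by (simp add: Q_def square_mat_mult)
  have AP: "A * (?P * M) = \<mu> \<cdot>\<^sub>m (?P * M)" if "M \<in> carrier_mat n n" for M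
    using that mult_eigenprojector[of \<mu>] square_mat_mult(2)[of A n ?P M]
    by (simp add: smult_square_mat_mult[where n = n])
  have BQ: "B * Q = \<mu> \<cdot>\<^sub>m (F * ?P * F)"
  proof -
    have "B * Q = F * (A * (F * Q))"
      using f(1) Q by (simp add: B_def square_mat_mult[where n = n])
    also have "\<dots> = \<mu> \<cdot>\<^sub>m (F * (?P * F))"
      using f(1) by (simp add: FQ AP smult_square_mat_mult[where n = n] square_mat_mult)
    finally show ?thesis
      using f(1) by (simp add: square_mat_mult[where n = n])
  qed
  have DQ: "mat_diag n \<delta> * Q = \<mu>\<^sup>2 \<cdot>\<^sub>m Q"
  proof -
    have "mat_diag n \<delta> * Q = mat_adjoint F * (A * (A * (F * Q)))"
      using f(1,2) Q by (simp add: BB_diag[symmetric] BB square_mat_mult[where n = n])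
    also have "\<dots> = \<mu>\<^sup>2 \<cdot>\<^sub>m Q"
    proof -
      have "A * (A * (F * Q)) = \<mu>\<^sup>2 \<cdot>\<^sub>m (?P * F)"
        using f(1)
        by (simp add: FQ AP smult_square_mat_mult[where n = n] square_mat_mult smult_smult_mat power2_eq_square)
      thus ?thesis
        using f(1,2) by (simp add: Q_def smult_square_mat_mult[where n = n] square_mat_mult)
    qed
    finally show ?thesis .
  qed
  \<comment> \<open>By \<open>DQ\<close>, row \<open>i\<close> of \<open>Q\<close> vanishes unless
    \<open>\<delta> i = \<mu>\<^sup>2\<close>. Taking adjoints carries this over to columns.\<close>
  have SQ: "S * Q = Q"
  proof (rule eq_matI)
    fix i j assume ij: "i < dim_row Q" "j < dim_col Q"
    hence "\<delta> i * Q $$ (i, j) = \<mu>\<^sup>2 * Q $$ (i, j)"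
      using arg_cong[OF DQ, of "\<lambda>M. M $$ (i, j)"] Q by (simp add: mat_diag_mult_left[OF Q])
    thus "(S * Q) $$ (i, j) = Q $$ (i, j)"
      using ij Q by (auto simp: S_def mat_diag_mult_left[OF Q])
  qed (use S Q in auto)
  have S_adj: "mat_adjoint S = S"
    by (rule eq_matI) (auto simp: S_def mat_diag_def)
  have QS: "Q * S = Q"
    using arg_cong[OF SQ, of mat_adjoint] by (simp add: mat_adjoint_mult[OF S Q] S_adj Q_adj)
  \<comment> \<open>The converse inclusion: the columns of \<open>F * S\<close> satisfy the
    eigenvalue equation of the square of \<open>A\<close> for \<open>\<mu>\<^sup>2\<close>, and have
    to be shown to satisfy that of \<open>A\<close> for \<mu>.\<close>
  have "Q * S = S"
  proof -
    define M where "M = F * S"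
    have M: "M \<in> carrier_mat n n"
      using f(1) S by (simp add: M_def square_mat_mult)
    have DS: "mat_diag n \<delta> * S = \<mu>\<^sup>2 \<cdot>\<^sub>m S"
      unfolding S_def mat_diag_diag by (rule eq_matI) (auto simp: mat_diag_def)
    have "A * (A * M) = A * (A * F) * S"
      using f(1) S by (simp add: M_def square_mat_mult[where n = n])
    also have "\<dots> = \<mu>\<^sup>2 \<cdot>\<^sub>m M"
      using f(1) S by (simp add: AAF M_def square_mat_mult[where n = n] DS smult_square_mat_mult[where n = n])
    finally have AAM: "A * (A * M) = \<mu>\<^sup>2 \<cdot>\<^sub>m M" .
    \<comment> \<open>Factor the squared equation: \<open>A\<close> acts on \<open>R\<close> as
      \<open>- \<mu>\<close>. Since no \<open>d i\<close> equals \<open>- \<mu>\<close>, the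
      projector for \<open>- \<mu>\<close> is zero, and it fixes \<open>R\<close>; so
      \<open>R\<close> is zero.\<close>
    define R where "R = A * M - \<mu> \<cdot>\<^sub>m M"
    have AM: "A * M \<in> carrier_mat n n"
      using M by (simp add: square_mat_mult)
    have R: "R \<in> carrier_mat n n"
      using AM M by (simp add: R_def minus_carrier_mat)
    have "A * R = A * (A * M) - A * (\<mu> \<cdot>\<^sub>m M)"
      using AM M by (simp add: R_def mult_minus_distrib_mat[of _ n n])
    also have "\<dots> = \<mu>\<^sup>2 \<cdot>\<^sub>m M - \<mu> \<cdot>\<^sub>m (A * M)"
      using M by (simp add: AAM smult_square_mat_mult[where n = n])
    also have "\<dots> = (- \<mu>) \<cdot>\<^sub>m R"
    proof (rule eq_matI)
      fix i j assume "i < dim_row ((- \<mu>) \<cdot>\<^sub>m R)" "j < dim_col ((- \<mu>) \<cdot>\<^sub>m R)"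
      hence ij: "i < n" "j < n" using R by auto
      have "\<mu>\<^sup>2 * m - \<mu> * a = - \<mu> * (a - \<mu> * m)" for a m
        by (simp add: power2_eq_square algebra_simps)
      thus "(\<mu>\<^sup>2 \<cdot>\<^sub>m M - \<mu> \<cdot>\<^sub>m (A * M)) $$ (i, j) = ((- \<mu>) \<cdot>\<^sub>m R) $$ (i, j)"
        using ij M AM R carrier_matD[OF carrier_A] unfolding R_def by (simp del: index_mult_mat(1))
    qed (use R M AM carrier_matD[OF carrier_A] in auto)
    finally have "eigenprojector n U d (- \<mu>) * R = R"
      by (rule eigenprojector_fixes[OF R])
    moreover have "eigenprojector n U d (- \<mu>) = 0\<^sub>m n n"
    proof -
      have "mat_diag n (\<lambda>i. if d i = - \<mu> then 1 else 0) = (0\<^sub>m n n :: complex mat)"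
        using \<mu>(2) by (intro eq_matI) (auto simp: mat_diag_def)
      thus ?thesis
        by (simp add: eigenprojector_def right_mult_zero_mat[OF carrier_U(1)] left_mult_zero_mat[OF carrier_U(2)])
    qed
    ultimately have R0: "R = 0\<^sub>m n n"
      using R by simp
    have "A * M = \<mu> \<cdot>\<^sub>m M"
    proof (rule eq_matI)
      fix i j assume "i < dim_row (\<mu> \<cdot>\<^sub>m M)" "j < dim_col (\<mu> \<cdot>\<^sub>m M)"
      thus "(A * M) $$ (i, j) = (\<mu> \<cdot>\<^sub>m M) $$ (i, j)"
        using arg_cong[OF R0, of "\<lambda>M. M $$ (i, j)"] carrier_matD[OF carrier_A] M
        by (simp add: R_def del: index_mult_mat(1))
    qed (use M carrier_matD[OF carrier_A] in auto)
    hence "?P * M = M"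
      by (rule eigenprojector_fixes[OF M])
    hence "Q * S = mat_adjoint F * (F * S)"
      using f(1,2) S by (simp add: Q_def M_def square_mat_mult[where n = n])
    thus ?thesis
      using unitary_mat_cancel(1)[OF F S] by simp
  qed
  \<comment> \<open>Now \<open>Q = Q * S = S\<close>. Up to the factor \<mu>, the sandwiched
    projector is \<open>B\<close> with the unselected columns deleted.\<close>
  hence "B * S = \<mu> \<cdot>\<^sub>m (F * ?P * F)"
    using BQ by (simp only: QS)
  hence eq0: "(B * S) $$ (i, j) = \<mu> * (F * ?P * F) $$ (i, j)"
    using ij f(1) by (simp del: index_mult_mat(1))
  have "(B * S) $$ (i, j) = B $$ (i, j) * (if \<delta> j = \<mu>\<^sup>2 then 1 else 0)"
    using ij by (simp add: S_def mat_diag_mult_right[OF B] del: index_mult_mat)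
  hence eq: "cmod \<mu> * cmod ((F * ?P * F) $$ (i, j)) = cmod (B $$ (i, j)) * (if \<delta> j = \<mu>\<^sup>2 then 1 else 0)"
    unfolding norm_mult[symmetric] eq0[symmetric] by (simp add: norm_mult)
  show ?thesis
  proof (cases "B $$ (i, j) \<noteq> 0 \<and> \<delta> j = \<mu>\<^sup>2")
    case True
    \<comment> \<open>The entry is alone in its column, so its squared modulus is
      \<open>\<delta> j = \<mu>\<^sup>2\<close>.\<close>
    have "B $$ (k, j) = 0" if "k \<in> {..<n} - {i}" for k
      using partial_monomialD(2)[OF mono[folded B_def] B, of i j k] that True ij by auto
    hence \<delta>_eq: "\<delta> j = complex_of_real ((cmod (B $$ (i, j)))\<^sup>2)"
      using ij by (simp add: \<delta>_def sum.remove[of _ i])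
    have "(cmod (B $$ (i, j)))\<^sup>2 = (cmod \<mu>)\<^sup>2"
    proof -
      have "(cmod (B $$ (i, j)))\<^sup>2 = cmod (\<delta> j)"
        by (simp only: \<delta>_eq norm_of_real abs_power2)
      also have "\<dots> = (cmod \<mu>)\<^sup>2"
        using True by (simp add: norm_power)
      finally show ?thesis .
    qed
    hence "cmod (B $$ (i, j)) = cmod \<mu>"
      by simp
    thus ?thesis
      using eq True \<mu>(1) by simp
  next
    case False
    thus ?thesis
      using eq \<mu>(1) by auto
  qed
qed

text \<open>For a regular graph of degree \<open>a\<close> the left side is the Laplacian, which is
  thus diagonalized by the same \<open>U\<close>.\<close>

lemma smult_one_minus: "a \<cdot>\<^sub>m 1\<^sub>m n - A = U * mat_diag n (\<lambda>i. a - d i) * mat_adjoint U"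
proof -
  have "mat_diag n (\<lambda>i. a - d i) = a \<cdot>\<^sub>m 1\<^sub>m n - mat_diag n d"
    by (rule eq_matI) (auto simp: mat_diag_def)
  hence "U * mat_diag n (\<lambda>i. a - d i) * mat_adjoint U = (U * (a \<cdot>\<^sub>m 1\<^sub>m n) - U * mat_diag n d) * mat_adjoint U"
    using mult_minus_distrib_mat[OF carrier_U(1), of "a \<cdot>\<^sub>m 1\<^sub>m n" n "mat_diag n d"] by simp
  also have "\<dots> = U * (a \<cdot>\<^sub>m 1\<^sub>m n) * mat_adjoint U - U * mat_diag n d * mat_adjoint U"
    by (rule minus_mult_distrib_mat[of _ n n _ _ n]) (simp_all add: square_mat_mult)
  also have "U * (a \<cdot>\<^sub>m 1\<^sub>m n) * mat_adjoint U = a \<cdot>\<^sub>m (U * mat_adjoint U)"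
    by (simp add: smult_square_mat_mult[where n = n] right_mult_one_mat[OF carrier_U(1)])
  finally show ?thesis
    by (simp add: A unitary_matD(4)[OF U])
qed

text \<open>Equality of the \<open>l\<^sup>1\<close>-norm of \<open>F A F\<close> with the trace norm of \<open>A\<close> is witnessed by the unitary
  \<open>F sgn(A) F\<close>, where \<open>sgn\<close> is modified to be 1 on the kernel of \<open>A\<close>.\<close>

lemma partial_monomial_sandwich:
  assumes F: "unitary_mat n F"
    and l1: "l1_norm_mat (F * A * F) = (\<Sum>i<n. cmod (d i))"
  shows "partial_monomial (F * A * F)"
proof -
  define s where "s i = (if d i = 0 then 1 else sgn (d i))" for i
  define W where "W = U * mat_diag n s * mat_adjoint U"
  have s: "cnj (s i) * s i = 1" "cnj (s i) * d i = complex_of_real (cmod (d i))" for i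
  proof -
    show "cnj (s i) * s i = 1"
      unfolding cnj_mult_self by (simp add: s_def norm_sgn)
    have "cnj (d i) * d i = complex_of_real (cmod (d i)) * complex_of_real (cmod (d i))"
      by (simp add: cnj_mult_self power2_eq_square)
    thus "cnj (s i) * d i = complex_of_real (cmod (d i))"
      by (simp add: s_def sgn_eq)
  qed
  have W: "W \<in> carrier_mat n n"
    unfolding W_def by (rule conj_diag_carrier)
  have W_adj: "mat_adjoint W = U * mat_diag n (\<lambda>i. cnj (s i)) * mat_adjoint U"
    unfolding W_def by (rule conj_diag_adjoint)
  have "mat_adjoint W * W = 1\<^sub>m n"
    unfolding W_adj unfolding W_def conj_diag_mult s(1)
    by (simp add: right_mult_one_mat[OF carrier_U(1)] unitary_matD(4)[OF U])
  hence "unitary_mat n W"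
    by (rule unitary_matI[OF W])
  hence FWF: "unitary_mat n (F * W * F)"
    by (intro unitary_mat_mult F)
  have WA: "mat_adjoint W * A \<in> carrier_mat n n"
    using W by (simp add: square_mat_mult)
  \<comment> \<open>After cancelling the Fourier factors, \<open>mat_adjoint W * A\<close> is the
    absolute value of \<open>A\<close>, whose trace is the sum of the moduli of the
    \<open>d i\<close>.\<close>
  have "mat_trace (mat_adjoint (F * W * F) * (F * A * F)) = mat_trace (mat_adjoint W * A)"
    unfolding mat_adjoint_sandwich[OF F W carrier_A] by (rule mat_trace_unitary_conj[OF F WA])
  also have "mat_adjoint W * A = U * mat_diag n (\<lambda>i. complex_of_real (cmod (d i))) * mat_adjoint U"
    unfolding W_adj A conj_diag_mult s(2) ..
  also have "mat_trace \<dots> = complex_of_real (l1_norm_mat (F * A * F))"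
    unfolding conj_diag_trace l1 by simp
  finally have tr: "mat_trace (mat_adjoint (F * W * F) * (F * A * F)) = complex_of_real (l1_norm_mat (F * A * F))" .
  have "F * A * F \<in> carrier_mat n n"
    using unitary_matD(1)[OF F] by (simp add: square_mat_mult)
  from partial_monomial_if_trace_eq_l1[OF FWF this tr] show ?thesis .
qed

end

section \<open>Adjacency and Laplacian matrices\<close>

lemma index_mult_mat_sum:
  assumes "A \<in> carrier_mat n m" "B \<in> carrier_mat m k" "i < n" "j < k"
  shows "(A * B) $$ (i, j) = (\<Sum>l<m. A $$ (i, l) * B $$ (l, j))"
  using assms by (simp add: scalar_prod_def atLeast0LessThan)

lemma finite_edges:
  assumes "simple_graph V E"
  shows "finite E"
  using assms finite_subset[of E "Pow V"] by (auto simp: simple_graph_def)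

text \<open>Degrees count incident edges, row sums count neighbours; sending \<open>v\<close> to the
  edge \<open>{u, v}\<close> is a bijection between the two.\<close>

lemma card_neighbours:
  assumes G: "simple_graph V E" and u: "u \<in> V"
  shows "card {v \<in> V. {u, v} \<in> E} = degree_of E u"
proof -
  have "bij_betw (\<lambda>v. {u, v}) {v \<in> V. {u, v} \<in> E} {e \<in> E. u \<in> e}"
  proof (rule bij_betw_imageI)
    show "inj_on (\<lambda>v. {u, v}) {v \<in> V. {u, v} \<in> E}"
      by (rule inj_onI) (simp only: doubleton_eq_iff, blast)
    have "e \<in> (\<lambda>v. {u, v}) ` {v \<in> V. {u, v} \<in> E}" if e: "e \<in> E" "u \<in> e" for e
    proof -
      have "card e = 2" "e \<subseteq> V"
        using G e(1) by (auto simp: simple_graph_def)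
      then obtain x y where xy: "e = {x, y}" "x \<in> V" "y \<in> V"
        by (auto simp: card_2_iff)
      then obtain v where v: "e = {u, v}" "v \<in> V"
        using e(2) by blast
      show ?thesis
        by (rule image_eqI[of _ _ v]) (use v e(1) in simp_all)
    qed
    thus "(\<lambda>v. {u, v}) ` {v \<in> V. {u, v} \<in> E} = {e \<in> E. u \<in> e}"
      by (intro equalityI subsetI) auto
  qed
  thus ?thesis
    unfolding degree_of_def by (rule bij_betw_same_card)
qed

text \<open>Double counting of incidences between vertices and edges.\<close>

lemma sum_degree:
  assumes G: "simple_graph V E"
  shows "(\<Sum>v\<in>V. degree_of E v) = 2 * card E"
proof -
  have fin: "finite E" "finite V"
    using G finite_edges by (auto simp: simple_graph_def)
  have "(\<Sum>v\<in>V. degree_of E v) = (\<Sum>v\<in>V. \<Sum>e\<in>E. if v \<in> e then 1 else 0)"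
    using fin by (simp add: degree_of_def flip: sum.inter_filter)
  also have "\<dots> = (\<Sum>e\<in>E. \<Sum>v\<in>V. if v \<in> e then 1 else 0)"
    by (rule sum.swap)
  also have "\<dots> = (\<Sum>e\<in>E. 2)"
  proof (rule sum.cong)
    fix e assume "e \<in> E"
    hence "V \<inter> e = e" "card e = 2"
      using G by (auto simp: simple_graph_def)
    thus "(\<Sum>v\<in>V. if v \<in> e then 1 else 0) = (2 :: nat)"
      using fin by (simp add: sum.If_cases)
  qed simp
  finally show ?thesis
    by simp
qed

context
  fixes V :: "'v set" and E :: "'v set set" and \<sigma> :: "'v \<Rightarrow> nat"
  assumes G: "simple_graph V E" and \<sigma>: "vertex_labeling V \<sigma>"
begin

lemma inv_labeling_in: "x < card V \<Longrightarrow> inv_into V \<sigma> x \<in> V"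
  using inv_into_labeling[OF \<sigma>] by (auto simp: bij_betw_def)

lemma inv_labeling_eq_iff:
  "x < card V \<Longrightarrow> y < card V \<Longrightarrow> inv_into V \<sigma> x = inv_into V \<sigma> y \<longleftrightarrow> x = y"
  using inv_into_labeling[OF \<sigma>] by (auto simp: bij_betw_def inj_on_def)

lemma sum_inv_labeling: "(\<Sum>x<card V. f (inv_into V \<sigma> x)) = (\<Sum>v\<in>V. f v)"
  using sum.reindex_bij_betw[OF inv_into_labeling[OF \<sigma>], of f] by (simp add: atLeast0LessThan)

lemma adjacency_mat_carrier: "adjacency_mat V E \<sigma> \<in> carrier_mat (card V) (card V)"
  by (simp add: adjacency_mat_def labeled_mat_def)

lemma index_adjacency_mat:
  assumes "x < card V" "y < card V"
  shows "adjacency_mat V E \<sigma> $$ (x, y) = (if {inv_into V \<sigma> x, inv_into V \<sigma> y} \<in> E then 1 else 0)"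
  using assms by (simp add: adjacency_mat_def labeled_mat_def)

lemma adjacency_mat_hermitian: "mat_adjoint (adjacency_mat V E \<sigma>) = adjacency_mat V E \<sigma>"
  by (rule eq_matI) (auto simp: adjacency_mat_def labeled_mat_def insert_commute)

lemma sum_row_adjacency_mat:
  assumes "x < card V"
  shows "(\<Sum>y<card V. adjacency_mat V E \<sigma> $$ (x, y)) = of_nat (degree_of E (inv_into V \<sigma> x))"
proof -
  have fin: "finite V"
    using G by (simp add: simple_graph_def)
  have "(\<Sum>y<card V. adjacency_mat V E \<sigma> $$ (x, y))
      = (\<Sum>y<card V. (\<lambda>v. if {inv_into V \<sigma> x, v} \<in> E then 1 else 0) (inv_into V \<sigma> y))"
    using assms by (simp add: index_adjacency_mat)
  also have "\<dots> = (\<Sum>v\<in>V. if {inv_into V \<sigma> x, v} \<in> E then 1 else 0)"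
    by (rule sum_inv_labeling)
  also have "\<dots> = of_nat (card {v \<in> V. {inv_into V \<sigma> x, v} \<in> E})"
    using fin by (simp flip: sum.inter_filter)
  finally show ?thesis
    using card_neighbours[OF G inv_labeling_in[OF assms]] by simp
qed

lemma sum_adjacency_mat:
  "(\<Sum>x<card V. \<Sum>y<card V. adjacency_mat V E \<sigma> $$ (x, y)) = of_nat (2 * card E)"
proof -
  have "(\<Sum>x<card V. \<Sum>y<card V. adjacency_mat V E \<sigma> $$ (x, y))
      = (\<Sum>x<card V. of_nat (degree_of E (inv_into V \<sigma> x)))"
    by (simp add: sum_row_adjacency_mat)
  also have "\<dots> = of_nat (\<Sum>v\<in>V. degree_of E v)"
    using sum_inv_labeling[of "\<lambda>v. of_nat (degree_of E v)"] by simp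
  finally show ?thesis
    unfolding sum_degree[OF G] .
qed

text \<open>The entries are their own squares and sum to twice the number of edges. This is the
  denominator in the hypothesis on the Fourier ratio.\<close>

lemma frobenius_norm_adjacency_mat: "frobenius_norm (adjacency_mat V E \<sigma>) = sqrt (2 * real (card E))"
proof -
  let ?A = "adjacency_mat V E \<sigma>"
  have "complex_of_real ((frobenius_norm ?A)\<^sup>2) = (\<Sum>x<card V. \<Sum>y<card V. ?A $$ (x, y))"
    unfolding frobenius_norm_square carrier_matD[OF adjacency_mat_carrier]
    by (auto simp: index_adjacency_mat intro!: sum.cong)
  hence "complex_of_real ((frobenius_norm ?A)\<^sup>2) = complex_of_real (2 * real (card E))"
    unfolding sum_adjacency_mat by simp
  hence "(frobenius_norm ?A)\<^sup>2 = 2 * real (card E)"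
    using of_real_eq_iff by blast
  thus ?thesis
    by (intro real_sqrt_unique[symmetric] frobenius_norm_nonneg)
qed

text \<open>The energy is defined through a chosen labeling; invariance of the characteristic
  polynomial moves it to \<sigma>.\<close>

lemma graph_energy_eq:
  assumes U: "unitary_mat (card V) U" and A: "adjacency_mat V E \<sigma> = U * mat_diag (card V) d * mat_adjoint U"
  shows "graph_energy V E = (\<Sum>i<card V. cmod (d i))"
proof -
  let ?C = "adjacency_mat V E (chosen_labeling V)"
  have "vertex_labeling V (chosen_labeling V)"
    using G by (intro vertex_labeling_chosen) (simp add: simple_graph_def)
  hence cp: "char_poly ?C = char_poly (adjacency_mat V E \<sigma>)"
    using \<sigma> by (rule char_poly_adjacency_mat)
  have "?C \<in> carrier_mat (card V) (card V)"
    by (simp add: adjacency_mat_def labeled_mat_def)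
  hence "spectrum ?C = spectrum (adjacency_mat V E \<sigma>)"
    using cp adjacency_mat_carrier by (simp add: spectrum_root_char_poly)
  thus ?thesis
    using sum_spectrum_order[OF U A, of cmod] by (simp add: graph_energy_def Let_def cp)
qed

section \<open>The Laplacian under a given labeling\<close>

lemma laplacian_mat_carrier: "laplacian_mat V E \<sigma> \<in> carrier_mat (card V) (card V)"
  by (simp add: laplacian_mat_labeled_mat labeled_mat_def)

lemma laplacian_mat_hermitian: "mat_adjoint (laplacian_mat V E \<sigma>) = laplacian_mat V E \<sigma>"
  by (rule eq_matI) (auto simp: laplacian_mat_labeled_mat labeled_mat_def insert_commute)

lemma laplacian_mat_regular:
  assumes "\<forall>v\<in>V. degree_of E v = a"
  shows "laplacian_mat V E \<sigma> = of_nat a \<cdot>\<^sub>m 1\<^sub>m (card V) - adjacency_mat V E \<sigma>"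
proof (rule eq_matI)
  fix x y
  assume "x < dim_row (of_nat a \<cdot>\<^sub>m 1\<^sub>m (card V) - adjacency_mat V E \<sigma>)"
    "y < dim_col (of_nat a \<cdot>\<^sub>m 1\<^sub>m (card V) - adjacency_mat V E \<sigma>)"
  hence xy: "x < card V" "y < card V"
    using carrier_matD[OF adjacency_mat_carrier] by simp_all
  thus "laplacian_mat V E \<sigma> $$ (x, y) = (of_nat a \<cdot>\<^sub>m 1\<^sub>m (card V) - adjacency_mat V E \<sigma>) $$ (x, y)"
    using assms inv_labeling_in[OF xy(1)] inv_labeling_in[OF xy(2)] carrier_matD[OF adjacency_mat_carrier]
    by (simp add: index_adjacency_mat laplacian_mat_labeled_mat labeled_mat_def inv_labeling_eq_iff)
qed (use carrier_matD[OF adjacency_mat_carrier] carrier_matD[OF laplacian_mat_carrier] in simp_all)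

lemma laplacian_multiplicity_eq:
  "laplacian_multiplicity V E \<mu> = order \<mu> (char_poly (laplacian_mat V E \<sigma>))"
  using char_poly_laplacian_mat[OF \<sigma> vertex_labeling_chosen, of E] G
  by (simp add: laplacian_multiplicity_def simple_graph_def)

lemma laplacian_spectrum_eq: "laplacian_spectrum V E = spectrum (laplacian_mat V E \<sigma>)"
  using spectrum_laplacian_mat[OF \<sigma> vertex_labeling_chosen, of E] G
  by (simp add: laplacian_spectrum_def simple_graph_def)

text \<open>Here \<sigma> is any labeling, so this is the lower bound for the minimum over all
  labelings.\<close>

lemma fourier_ratio_laplacian_projector_ge:
  "fourier_ratio (laplacian_projector V E \<mu> \<sigma>) \<ge> sqrt (real (laplacian_multiplicity V E \<mu>))"
proof -
  obtain U d where "unitary_mat (card V) U" "laplacian_mat V E \<sigma> = U * mat_diag (card V) d * mat_adjoint U"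
    using hermitian_diagonalization[OF laplacian_mat_carrier laplacian_mat_hermitian] by blast
  then interpret unitary_diagonalization "card V" U "laplacian_mat V E \<sigma>" d
    by unfold_locales
  show ?thesis
    unfolding laplacian_projector_def orthogonal_projector_eigenspace laplacian_multiplicity_eq
    by (rule fourier_ratio_projector_ge[OF eigenprojector_carrier eigenprojector_adjoint
        eigenprojector_idem eigenprojector_trace])
qed

text \<open>Since \<open>B = F A F\<close> has \<open>B\<^sub>0\<^sub>0 \<noteq> 0\<close>, the rest of its column 0 vanishes, and column 0 of
  \<open>A F = F\<^sup>* B\<close> says that all degrees are equal to \<open>B\<^sub>0\<^sub>0\<close>.\<close>

lemma regular_if_partial_monomial:
  assumes mono: "partial_monomial (fourier_mat (card V) * adjacency_mat V E \<sigma> * fourier_mat (card V))"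
    and edges: "card E > 0"
  shows "\<exists>a. \<forall>v\<in>V. degree_of E v = a"
proof -
  define n where "n = card V"
  define A where "A = adjacency_mat V E \<sigma>"
  define F where "F = fourier_mat n"
  define B where "B = F * A * F"
  define deg where "deg x = degree_of E (inv_into V \<sigma> x)" for x
  have A: "A \<in> carrier_mat n n" and F: "F \<in> carrier_mat n n"
    using adjacency_mat_carrier by (simp_all add: A_def F_def n_def)
  have FU: "unitary_mat n F"
    unfolding F_def by (rule unitary_fourier_mat)
  have AF: "A * F \<in> carrier_mat n n" and B: "B \<in> carrier_mat n n"
    using A F by (simp_all add: B_def square_mat_mult)
  have "V \<noteq> {}"
    using edges G by (auto simp: simple_graph_def card_gt_0_iff)
  hence n: "0 < n"
    using G by (simp add: n_def simple_graph_def card_gt_0_iff)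
  have F0: "F $$ (0, x) = 1 / sqrt n" "F $$ (x, 0) = 1 / sqrt n" if "x < n" for x
    using that n by (simp_all add: F_def index_fourier_mat)
  \<comment> \<open>Column 0 of the Fourier matrix is constant, so column 0 of \<open>A * F\<close>
    consists of scaled row sums of \<open>A\<close>.\<close>
  have AF0: "(A * F) $$ (x, 0) = of_nat (deg x) / sqrt n" if x: "x < n" for x
  proof -
    have "(A * F) $$ (x, 0) = (\<Sum>y<n. A $$ (x, y) * (1 / sqrt n))"
      using index_mult_mat_sum[OF A F x n] by (simp add: F0)
    also have "\<dots> = (\<Sum>y<n. A $$ (x, y)) / sqrt n"
      by (simp flip: sum_divide_distrib)
    finally show ?thesis
      using sum_row_adjacency_mat[of x] x by (simp add: A_def n_def deg_def)
  qed
  have B_eq: "B = F * (A * F)"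
    using A F by (simp add: B_def square_mat_mult[where n = n])
  have sq: "complex_of_real (sqrt n) * complex_of_real (sqrt n) = of_nat n"
    by (simp flip: of_real_mult)
  \<comment> \<open>This entry is the average degree, which is nonzero because there is an
    edge.\<close>
  have "B $$ (0, 0) = (\<Sum>x<n. of_nat (deg x) / of_nat n)"
    unfolding B_eq index_mult_mat_sum[OF F AF n n] by (intro sum.cong refl) (simp add: F0 AF0 sq)
  also have "\<dots> = of_nat (\<Sum>x<n. deg x) / of_nat n"
    by (simp flip: sum_divide_distrib)
  also have "(\<Sum>x<n. deg x) = 2 * card E"
    using sum_inv_labeling[of "degree_of E"] sum_degree[OF G] by (simp add: n_def deg_def)
  finally have "B $$ (0, 0) \<noteq> 0"
    using edges n by simp
  hence B0: "B $$ (m, 0) = 0" if "m \<in> {..<n} - {0}" for m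
    using partial_monomialD(2)[OF mono[folded n_def, folded A_def F_def, folded B_def] B, of 0 0 m] that n by auto
  have deg_eq: "of_nat (deg x) = B $$ (0, 0)" if x: "x < n" for x
  proof -
    have "A * F = mat_adjoint F * B"
      unfolding B_eq using unitary_mat_cancel(1)[OF FU AF] by simp
    hence "(A * F) $$ (x, 0) = (\<Sum>m<n. mat_adjoint F $$ (x, m) * B $$ (m, 0))"
      using index_mult_mat_sum[OF unitary_matD(2)[OF FU] B x n] by simp
    also have "\<dots> = mat_adjoint F $$ (x, 0) * B $$ (0, 0)"
      using n B0 by (simp add: sum.remove[of _ 0])
    also have "mat_adjoint F $$ (x, 0) = 1 / sqrt n"
      using x n F by (simp add: F0)
    finally show ?thesis
      using AF0[OF x] n by simp
  qed
  have "degree_of E v = deg 0" if v: "v \<in> V" for v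
  proof -
    have "v \<in> inv_into V \<sigma> ` {0..<n}"
      using v inv_into_labeling[OF \<sigma>] by (simp add: n_def bij_betw_def)
    then obtain x where x: "x < n" "v = inv_into V \<sigma> x"
      by auto
    have "(of_nat (deg x) :: complex) = of_nat (deg 0)"
      using deg_eq x(1) n by simp
    thus ?thesis
      using x(2) by (simp add: deg_def)
  qed
  thus ?thesis
    by blast
qed

end

theorem corollary2p15:
  fixes V :: "'v set" and E :: "'v set set" and \<sigma> :: "'v \<Rightarrow> nat"
  assumes "simple_graph V E"
    and "card E > 0"
    and "vertex_labeling V \<sigma>"
    and "fourier_ratio (adjacency_mat V E \<sigma>) = graph_energy V E / sqrt (2 * real (card E))"
  shows "\<exists>a::nat. (\<forall>v\<in>V. degree_of E v = a) \<and>
    (\<forall>\<mu>. \<mu> \<in> laplacian_spectrum V E \<and> 2 * of_nat a - \<mu> \<notin> laplacian_spectrum V E \<longrightarrow>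
      fourier_ratio (laplacian_projector V E \<mu> \<sigma>) = fourier_ratio_min V E \<mu> \<and>
      fourier_ratio_min V E \<mu> = sqrt (real (laplacian_multiplicity V E \<mu>)))"
proof -
  note G = assms(1) and \<sigma> = assms(3)
  define n where "n = card V"
  define A where "A = adjacency_mat V E \<sigma>"
  define F where "F = fourier_mat n"
  have A: "A \<in> carrier_mat n n" "mat_adjoint A = A"
    unfolding A_def n_def by (rule adjacency_mat_carrier[OF G \<sigma>] adjacency_mat_hermitian[OF G \<sigma>])+
  obtain U d where U: "unitary_mat n U" and AU: "A = U * mat_diag n d * mat_adjoint U"
    using hermitian_diagonalization[OF A] by blast
  interpret A: unitary_diagonalization n U A d
    by unfold_locales (fact U AU)+
  have F: "unitary_mat n F"
    unfolding F_def by (rule unitary_fourier_mat)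
  \<comment> \<open>Both sides of the hypothesis have the same positive denominator, so it reduces
    to equality of the entrywise norm with the energy.\<close>
  have "fourier_ratio A = l1_norm_mat (F * A * F) / sqrt (2 * real (card E))"
    using fourier_ratio_unitary[OF A(1)] frobenius_norm_adjacency_mat[OF G \<sigma>] by (simp add: A_def F_def)
  from trans[OF this[symmetric] assms(4)[folded A_def]]
  have "l1_norm_mat (F * A * F) / sqrt (2 * real (card E)) = graph_energy V E / sqrt (2 * real (card E))" .
  hence "l1_norm_mat (F * A * F) = graph_energy V E"
    using assms(2) by simp
  also have "\<dots> = (\<Sum>i<n. cmod (d i))"
    using graph_energy_eq[OF G \<sigma>] U AU unfolding A_def n_def by blast
  finally have mono: "partial_monomial (F * A * F)"
    by (rule A.partial_monomial_sandwich[OF F])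
  obtain a where a: "\<forall>v\<in>V. degree_of E v = a"
    using regular_if_partial_monomial[OF G \<sigma> mono[unfolded F_def A_def n_def] assms(2)] by blast
  define L where "L = laplacian_mat V E \<sigma>"
  have LU: "L = U * mat_diag n (\<lambda>i. of_nat a - d i) * mat_adjoint U"
    using laplacian_mat_regular[OF G \<sigma> a] A.smult_one_minus[of "of_nat a"]
    by (simp add: L_def A_def n_def)
  interpret L: unitary_diagonalization n U L "\<lambda>i. of_nat a - d i"
    by unfold_locales (fact U LU)+
  have spec: "laplacian_spectrum V E = (\<lambda>i. of_nat a - d i) ` {..<n}"
    using laplacian_spectrum_eq[OF G \<sigma>] spectrum_unitary_conj_diag[OF U LU] by (simp add: L_def)
  have "fourier_ratio (laplacian_projector V E \<mu> \<sigma>) = fourier_ratio_min V E \<mu> \<and>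
      fourier_ratio_min V E \<mu> = sqrt (real (laplacian_multiplicity V E \<mu>))"
    if \<mu>: "\<mu> \<in> laplacian_spectrum V E" "2 * of_nat a - \<mu> \<notin> laplacian_spectrum V E" for \<mu>
  proof -
    let ?m = "laplacian_multiplicity V E \<mu>" and ?\<nu> = "of_nat a - \<mu>"
    let ?P = "eigenprojector n U (\<lambda>i. of_nat a - d i) \<mu>"
    have P: "laplacian_projector V E \<mu> \<sigma> = ?P"
      using L.orthogonal_projector_eigenspace[of \<mu>] by (simp add: laplacian_projector_def L_def n_def)
    \<comment> \<open>The \<mu>-eigenspace of the Laplacian is the eigenspace of \<open>A\<close>
      for \<open>a - \<mu>\<close>.\<close>
    have "(of_nat a - d i = \<mu>) = (d i = ?\<nu>)" for i
      by (auto simp: algebra_simps)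
    hence P': "?P = eigenprojector n U d ?\<nu>"
      by (simp add: eigenprojector_def)
    \<comment> \<open>The negative of \<open>?\<nu>\<close> as an eigenvalue of \<open>A\<close>
      corresponds to \<open>2 * a - \<mu>\<close> in the Laplacian spectrum, which is
      excluded.\<close>
    have "d i \<noteq> - ?\<nu>" if "i < n" for i
    proof
      assume "d i = - ?\<nu>"
      hence "2 * of_nat a - \<mu> = of_nat a - d i"
        by simp
      thus False
        using \<mu>(2) that unfolding spec by blast
    qed
    \<comment> \<open>If \<open>?\<nu>\<close> were 0, the excluded value
      \<open>2 * a - \<mu>\<close> would be \<mu> itself, which lies in the spectrum.\<close>
    moreover have "?\<nu> \<noteq> 0"
    proof
      assume "?\<nu> = 0"
      hence "2 * of_nat a - \<mu> = \<mu>"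
        by (simp add: algebra_simps)
      thus False
        using \<mu> by simp
    qed
    ultimately have entries: "cmod ((fourier_mat n * ?P * fourier_mat n) $$ (i, j)) \<in> {0, 1}" if "i < n" "j < n" for i j
      using A.cmod_eigenprojector_sandwich[OF F A(2) mono _ _ that] unfolding P' F_def by blast
    have eq: "fourier_ratio (laplacian_projector V E \<mu> \<sigma>) = sqrt (real ?m)"
      unfolding P laplacian_multiplicity_eq[OF G \<sigma>] L_def[symmetric]
      by (rule fourier_ratio_projector_eq[OF L.eigenprojector_carrier L.eigenprojector_adjoint
          L.eigenprojector_idem L.eigenprojector_trace entries])
    have "finite V"
      using G by (simp add: simple_graph_def)
    \<comment> \<open>The lower bound holds for every labeling and is attained at \<sigma>.\<close>
    hence "fourier_ratio_min V E \<mu> = sqrt (real ?m)"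
      unfolding fourier_ratio_min_def
    proof (intro Min_eqI finite_projector_ratios)
      fix r assume "r \<in> {fourier_ratio (laplacian_projector V E \<mu> \<tau>) |\<tau>. vertex_labeling V \<tau>}"
      thus "sqrt (real ?m) \<le> r"
        using fourier_ratio_laplacian_projector_ge[OF G] by blast
    next
      show "sqrt (real ?m) \<in> {fourier_ratio (laplacian_projector V E \<mu> \<tau>) |\<tau>. vertex_labeling V \<tau>}"
        using eq[symmetric] \<sigma> by blast
    qed
    with eq show ?thesis
      by simp
  qed
  with a show ?thesis
    by blast
qed

end
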